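(* Let $\mathfrak{g}$ be a Kac--Moody algebra over $\mathbb{C}$, let $\lambda\in\mathfrak{h}^*$, and let $V$ be a nonzero highest weight $\mathfrak{g}$-module with highest weight $\lambda$. Then $$\mathrm{wt}\,V=\mathrm{wt}_{J_\lambda}V-\mathbb{Z}_{\geq0}\Delta_{J_\lambda^c,1}=\mathrm{wt}_{J_\lambda}V-\mathbb{Z}_{\geq0}(\Delta^+\setminus\Delta_{J_\lambda}^+).$$ More strongly, for arbitrary $J\subset\mathcal{I}$, $$\mathrm{wt}_JV-\mathbb{Z}_{\geq0}\Pi_{J^c}\subset\mathrm{wt}\,V\quad\Longleftrightarrow\quad\mathrm{wt}\,V=\mathrm{wt}_JV-\mathbb{Z}_{\geq0}\Delta_{J^c,1}.$$
   Context: $\mathfrak{g}=\mathfrak{g}(A)$ is the Kac--Moody algebra of a generalized Cartan matrix $A$, with Cartan subalgebra $\mathfrak{h}$, simple roots $\Pi=\{\alpha_i\}_{i\in\mathcal{I}}$, simple coroots $\alpha_i^\vee$ ($\mathcal{I}$ finite), root system $\Delta$ and positive roots $\Delta^+$. $\mathrm{wt}\,V\subset\mathfrak{h}^*$ is the set of weights of $V$. $J_\lambda=\{j\in\mathcal{I}\mid\langle\lambda,\alpha_j^\vee\rangle\in\mathbb{Z}_{\ge0}\}$. For $J\subset\mathcal{I}$: $J^c=\mathcal{I}\setminus J$, $\Pi_J=\{\alpha_j\mid j\in J\}$, $\Delta_J^+=\Delta^+\cap\mathbb{Z}\Pi_J$, $\mathrm{wt}_JV=\mathrm{wt}\,V\cap(\lambda-\mathbb{Z}_{\ge0}\Pi_J)$.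 For $x=\sum_ic_i\alpha_i$, $\mathrm{ht}_J(x)=\sum_{i\in J}c_i$; $\Delta_{J,1}=\{\beta\in\Delta\mid\mathrm{ht}_J(\beta)=1\}$ if $J\neq\emptyset$, and $\Delta_{\emptyset,1}=\emptyset$. $\mathbb{Z}_{\ge0}S$ is the set of finite $\mathbb{Z}_{\ge0}$-linear combinations of elements of $S$, with $\mathbb{Z}_{\ge0}\emptyset=\{0\}$; $C-D=\{c-d\mid c\in C,d\in D\}$. *)

theory Defs
  imports "HOL-Analysis.Cartesian_Space" "HOL-Library.Function_Algebras"
begin

section \<open>Complex vector spaces and Lie algebras\<close>

class complex_vector = ab_group_add +
  fixes scaleC :: "complex \<Rightarrow> 'a \<Rightarrow> 'a"  (infixr "*\<^sub>C" 75)
  assumes scaleC_add_right: "a *\<^sub>C (x + y) = a *\<^sub>C x + a *\<^sub>C y"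
    and scaleC_add_left: "(a + b) *\<^sub>C x = a *\<^sub>C x + b *\<^sub>C x"
    and scaleC_scaleC: "a *\<^sub>C b *\<^sub>C x = (a * b) *\<^sub>C x"
    and scaleC_one: "1 *\<^sub>C x = x"

global_interpretation complex_vector: vector_space "scaleC :: complex \<Rightarrow> 'a \<Rightarrow> 'a::complex_vector"
  by standard (simp_all add: scaleC_add_right scaleC_add_left scaleC_scaleC scaleC_one)

instantiation complex :: complex_vector
begin
definition scaleC_complex_def: "a *\<^sub>C (x::complex) = a * x"
instance by standard (simp_all add: scaleC_complex_def algebra_simps)
end

instantiation "fun" :: (type, complex_vector) complex_vector
begin
definition scaleC_fun_def: "a *\<^sub>C f = (\<lambda>x. a *\<^sub>C f x)"
instance
  by standard (simp_all add: scaleC_fun_def fun_eq_iff scaleC_add_right scaleC_add_left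
    scaleC_scaleC scaleC_one)
end

abbreviation clinear :: "('a::complex_vector \<Rightarrow> 'b::complex_vector) \<Rightarrow> bool"
  where "clinear \<equiv> Vector_Spaces.linear scaleC scaleC"

definition dual :: "('h::complex_vector \<Rightarrow> complex) set"
  where "dual = {\<mu>. clinear \<mu>}"

class complex_lie_algebra = complex_vector +
  fixes bracket :: "'a \<Rightarrow> 'a \<Rightarrow> 'a"
  assumes bracket_add_left: "bracket (x + y) z = bracket x z + bracket y z"
    and bracket_add_right: "bracket x (y + z) = bracket x y + bracket x z"
    and bracket_scaleC_left: "bracket (a *\<^sub>C x) y = a *\<^sub>C bracket x y"
    and bracket_scaleC_right: "bracket x (a *\<^sub>C y) = a *\<^sub>C bracket x y"
    and bracket_self: "bracket x x = 0"
    and jacobi: "bracket x (bracket y z) + bracket y (bracket z x) + bracket z (bracket x y) = 0"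

definition lie_subalgebra :: "'g::complex_lie_algebra set \<Rightarrow> bool"
  where "lie_subalgebra L \<longleftrightarrow>
    complex_vector.subspace L \<and> (\<forall>x\<in>L. \<forall>y\<in>L. bracket x y \<in> L)"

definition lie_ideal :: "'g::complex_lie_algebra set \<Rightarrow> bool"
  where "lie_ideal L \<longleftrightarrow>
    complex_vector.subspace L \<and> (\<forall>x. \<forall>y\<in>L. bracket x y \<in> L)"

definition lie_generated :: "'g::complex_lie_algebra set \<Rightarrow> 'g set"
  where "lie_generated S = \<Inter>{L. lie_subalgebra L \<and> S \<subseteq> L}"

definition lie_module :: "('g::complex_lie_algebra \<Rightarrow> 'v::complex_vector \<Rightarrow> 'v) \<Rightarrow> bool"
  where "lie_module act \<longleftrightarrow>
    (\<forall>x. clinear (act x)) \<and> (\<forall>v. clinear (\<lambda>x. act x v)) \<and>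
    (\<forall>x y v. act (bracket x y) v = act x (act y v) - act y (act x v))"

definition submodule :: "('g::complex_lie_algebra \<Rightarrow> 'v::complex_vector \<Rightarrow> 'v) \<Rightarrow> 'v set \<Rightarrow> bool"
  where "submodule act W \<longleftrightarrow>
    complex_vector.subspace W \<and> (\<forall>x. \<forall>w\<in>W. act x w \<in> W)"

definition generated_submodule ::
    "('g::complex_lie_algebra \<Rightarrow> 'v::complex_vector \<Rightarrow> 'v) \<Rightarrow> 'v set \<Rightarrow> 'v set"
  where "generated_submodule act S = \<Inter>{W. submodule act W \<and> S \<subseteq> W}"


section \<open>Kac--Moody algebras\<close>

locale generalized_cartan_matrix =
  fixes A :: "int ^ 'i::finite ^ 'i"
  assumes diag: "A $ i $ i = 2"
    and off_diag: "i \<noteq> j \<Longrightarrow> A $ i $ j \<le> 0"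
    and zero_sym: "A $ i $ j = 0 \<Longrightarrow> A $ j $ i = 0"

text \<open>
  A (minimal) realization of \<open>A\<close> in the sense of Kac. The library's dimension is \<open>0\<close> on
  infinite-dimensional spaces; as the rank is at most the size of \<open>A\<close>, the last condition forces
  the dimension to be positive, hence the Cartan subalgebra to be finite-dimensional.
\<close>

locale realization = generalized_cartan_matrix A
  for A :: "int ^ 'i::finite ^ 'i" +
  fixes coroot :: "'i \<Rightarrow> 'h::complex_vector"
    and \<alpha> :: "'i \<Rightarrow> 'h \<Rightarrow> complex"
  assumes root_dual: "\<alpha> i \<in> dual"
    and roots_indep: "inj \<alpha>" "\<not> complex_vector.dependent (range \<alpha>)"
    and coroots_indep: "inj coroot" "\<not> complex_vector.dependent (range coroot)"
    and pairing: "\<alpha> j (coroot i) = of_int (A $ i $ j)"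
    and dim_cartan: "complex_vector.dim (UNIV :: 'h set)
        + rank (\<chi> i j. (of_int (A $ i $ j) :: complex)) = 2 * CARD('i)"

text \<open>
  The Kac--Moody algebra of \<open>A\<close>: the Lie algebra on the Cartan subalgebra (embedded by
  \<open>\<iota>\<close>) and the Chevalley generators \<open>e\<^sub>i\<close>, \<open>f\<^sub>i\<close>, subject to the relations below, divided by the
  largest ideal that meets the Cartan subalgebra trivially. For a Lie algebra generated by these
  elements, having been divided by that ideal means that no nonzero ideal meets the Cartan
  subalgebra trivially.
\<close>

locale kac_moody_algebra = realization A coroot \<alpha>
  for A :: "int ^ 'i::finite ^ 'i"
    and coroot :: "'i \<Rightarrow> 'h::complex_vector"
    and \<alpha> :: "'i \<Rightarrow> 'h \<Rightarrow> complex" +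
  fixes \<iota> :: "'h \<Rightarrow> 'g::complex_lie_algebra"
    and e f :: "'i \<Rightarrow> 'g"
  assumes cartan_linear: "clinear \<iota>"
    and cartan_inj: "inj \<iota>"
    and cartan_abelian: "bracket (\<iota> h) (\<iota> h') = 0"
    and bracket_e_f: "bracket (e i) (f j) = (if i = j then \<iota> (coroot i) else 0)"
    and bracket_h_e: "bracket (\<iota> h) (e i) = \<alpha> i h *\<^sub>C e i"
    and bracket_h_f: "bracket (\<iota> h) (f i) = - (\<alpha> i h *\<^sub>C f i)"
    and generated: "lie_generated (range \<iota> \<union> range e \<union> range f) = UNIV"
    and no_ideal: "lie_ideal L \<Longrightarrow> L \<inter> range \<iota> = {0} \<Longrightarrow> L = {0}"


section \<open>Weights, roots and highest weight modules\<close>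

definition weight_space ::
    "('h::complex_vector \<Rightarrow> 'g) \<Rightarrow> ('g \<Rightarrow> 'v::complex_vector \<Rightarrow> 'v) \<Rightarrow> ('h \<Rightarrow> complex) \<Rightarrow> 'v set"
  where "weight_space \<iota> act \<mu> = {v. \<forall>h. act (\<iota> h) v = \<mu> h *\<^sub>C v}"

definition wt ::
    "('h::complex_vector \<Rightarrow> 'g) \<Rightarrow> ('g \<Rightarrow> 'v::complex_vector \<Rightarrow> 'v) \<Rightarrow> ('h \<Rightarrow> complex) set"
  where "wt \<iota> act = {\<mu> \<in> dual. weight_space \<iota> act \<mu> \<noteq> {0}}"

definition nat_combs :: "'a::complex_vector set \<Rightarrow> 'a set"
  where "nat_combs S = {\<Sum>s\<in>T. of_nat (n s) *\<^sub>C s | T (n :: 'a \<Rightarrow> nat). finite T \<and> T \<subseteq> S}"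

definition int_combs :: "'a::complex_vector set \<Rightarrow> 'a set"
  where "int_combs S = {\<Sum>s\<in>T. of_int (n s) *\<^sub>C s | T (n :: 'a \<Rightarrow> int). finite T \<and> T \<subseteq> S}"

text \<open>Not the library's \<open>C - D\<close>, which on sets is the set-theoretic difference.\<close>

definition minkowski_diff :: "'a::minus set \<Rightarrow> 'a set \<Rightarrow> 'a set"  (infixl "\<ominus>" 65)
  where "C \<ominus> D = {c - d | c d. c \<in> C \<and> d \<in> D}"

definition roots :: "('h::complex_vector \<Rightarrow> 'g::complex_lie_algebra) \<Rightarrow> ('h \<Rightarrow> complex) set"
  where "roots \<iota> = wt \<iota> bracket - {0}"

definition pos_roots ::
    "('h::complex_vector \<Rightarrow> 'g::complex_lie_algebra) \<Rightarrow> ('i \<Rightarrow> 'h \<Rightarrow> complex) \<Rightarrow> ('h \<Rightarrow> complex) set"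
  where "pos_roots \<iota> \<alpha> = roots \<iota> \<inter> nat_combs (range \<alpha>)"

definition pos_roots_of ::
    "('h::complex_vector \<Rightarrow> 'g::complex_lie_algebra) \<Rightarrow> ('i \<Rightarrow> 'h \<Rightarrow> complex) \<Rightarrow> 'i set
      \<Rightarrow> ('h \<Rightarrow> complex) set"
  where "pos_roots_of \<iota> \<alpha> J = pos_roots \<iota> \<alpha> \<inter> int_combs (\<alpha> ` J)"

text \<open>
  The coefficients are unique because the simple roots are linearly independent; the height is
  meaningful only on the span of the simple roots, which contains all roots.
\<close>

definition ht :: "('i::finite \<Rightarrow> 'h \<Rightarrow> complex) \<Rightarrow> 'i set \<Rightarrow> ('h \<Rightarrow> complex) \<Rightarrow> complex"
  where "ht \<alpha> J x = (\<Sum>i\<in>J. (THE c. x = (\<Sum>k\<in>UNIV. c k *\<^sub>C \<alpha> k)) i)"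

definition roots_ht1 ::
    "('h::complex_vector \<Rightarrow> 'g::complex_lie_algebra) \<Rightarrow> ('i::finite \<Rightarrow> 'h \<Rightarrow> complex) \<Rightarrow> 'i set
      \<Rightarrow> ('h \<Rightarrow> complex) set"
  where "roots_ht1 \<iota> \<alpha> J = (if J = {} then {} else {\<beta> \<in> roots \<iota>. ht \<alpha> J \<beta> = 1})"

definition integrable_nodes :: "('i \<Rightarrow> 'h) \<Rightarrow> ('h \<Rightarrow> complex) \<Rightarrow> 'i set"
  where "integrable_nodes coroot lam = {j. lam (coroot j) \<in> \<nat>}"

definition wt_of ::
    "('h::complex_vector \<Rightarrow> 'g) \<Rightarrow> ('i \<Rightarrow> 'h \<Rightarrow> complex) \<Rightarrow> ('g \<Rightarrow> 'v::complex_vector \<Rightarrow> 'v)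
      \<Rightarrow> ('h \<Rightarrow> complex) \<Rightarrow> 'i set \<Rightarrow> ('h \<Rightarrow> complex) set"
  where "wt_of \<iota> \<alpha> act lam J = wt \<iota> act \<inter> ({lam} \<ominus> nat_combs (\<alpha> ` J))"

text \<open>
  The subalgebra generated by the \<open>e\<^sub>i\<close> is the positive part of the triangular decomposition.
  The zero module is not excluded here.
\<close>

definition highest_weight_module ::
    "('h::complex_vector \<Rightarrow> 'g::complex_lie_algebra) \<Rightarrow> ('i \<Rightarrow> 'g)
      \<Rightarrow> ('g \<Rightarrow> 'v::complex_vector \<Rightarrow> 'v) \<Rightarrow> ('h \<Rightarrow> complex) \<Rightarrow> bool"
  where "highest_weight_module \<iota> e act lam \<longleftrightarrow> lie_module act \<and>
    (\<exists>v \<in> weight_space \<iota> act lam.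
      (\<forall>x \<in> lie_generated (range e). act x v = 0) \<and> generated_submodule act {v} = UNIV)"

end

theory Submission
  imports Defs "HOL-Library.Product_Plus"
begin

text \<open>
  Write \<open>K\<close> for the complement of \<open>J\<close> and \<open>D\<close> for the roots of \<open>K\<close>-height \<open>1\<close>. The module is spanned by
  vectors \<open>z\<^sub>1 \<dots> z\<^sub>k w\<close> with \<open>z\<^sub>i\<close> in root spaces \<open>-\<beta>\<^sub>i\<close>, \<open>\<beta>\<^sub>i \<in> D\<close>, and \<open>w\<close> of weight in
  \<open>\<lambda> - \<int>\<^sub>\<ge>\<^sub>0 \<Pi>\<^sub>J\<close>, because this span is stable under every \<open>f\<^sub>i\<close>; hence every weight has the required
  form. The same argument in the adjoint representation writes a positive root outside \<open>\<Delta>\<^sub>J\<close> as a sum of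
  elements of \<open>D\<close>.

  Conversely, assume that all \<open>\<mu> - \<int>\<^sub>\<ge>\<^sub>0 \<Pi>\<^sub>K\<close>, \<open>\<mu> \<in> wt\<^sub>J V\<close>, consist of weights. That
  \<open>\<mu> - (\<beta>\<^sub>1 + \<dots> + \<beta>\<^sub>k)\<close> is a weight follows by induction on the \<open>J\<close>-height of the sum: if some \<open>\<beta>\<^sub>i\<close> is
  not simple, then \<open>\<beta>\<^sub>i - \<alpha>\<^sub>j\<close> is a root for some \<open>j \<in> J\<close>; moving all \<open>\<beta>\<^sub>i\<close> up their \<open>\<alpha>\<^sub>j\<close>-strings
  lowers the height, and representation theory of \<open>sl\<^sub>2\<close> leads back down, after moving \<open>\<mu>\<close> along its own
  \<open>\<alpha>\<^sub>j\<close>-string if necessary.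

  For \<open>J = J\<^sub>\<lambda>\<close> the assumption holds since \<open>f\<^sub>i\<close>, \<open>i \<in> K\<close>, is injective on the simple quotient: its torsion
  there is a submodule that does not contain the highest weight vector. So some word in the \<open>e\<^sub>i\<close>, \<open>i \<in> K\<close>,
  carries a given word in the \<open>f\<^sub>i\<close> back to the highest weight vector, and it commutes with all \<open>f\<^sub>j\<close>,
  \<open>j \<in> J\<close>.
\<close>

section \<open>Linear maps and the dual space\<close>

lemma clinear_iff:
  "clinear g \<longleftrightarrow> (\<forall>x y. g (x + y) = g x + g y) \<and> (\<forall>c x. g (c *\<^sub>C x) = c *\<^sub>C g x)"
  by (simp add: Vector_Spaces.linear_def module_hom_def module_hom_axioms_def
      complex_vector.module_axioms complex_vector.vector_space_axioms)

lemma clinear_span: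
  assumes g: "clinear g" and X: "\<And>x. x \<in> X \<Longrightarrow> g x \<in> complex_vector.span Y"
    and x: "x \<in> complex_vector.span X"
  shows "g x \<in> complex_vector.span Y"
  using x
proof (induction rule: complex_vector.span_induct_alt)
  case base
  have "g 0 = g (0 *\<^sub>C 0)" by simp
  also have "\<dots> = 0 *\<^sub>C g 0" using g by (simp only: clinear_iff)
  finally show ?case by (simp add: complex_vector.span_zero)
next
  case (step c x y)
  then show ?case using g X by (simp add: clinear_iff complex_vector.span_add complex_vector.span_scale)
qed

lemma dual_closed:
  shows "0 \<in> dual" "\<mu> \<in> dual \<Longrightarrow> \<nu> \<in> dual \<Longrightarrow> \<mu> + \<nu> \<in> dual"
    "\<mu> \<in> dual \<Longrightarrow> \<nu> \<in> dual \<Longrightarrow> \<mu> - \<nu> \<in> dual"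
    "\<mu> \<in> dual \<Longrightarrow> - \<mu> \<in> dual" "\<mu> \<in> dual \<Longrightarrow> c *\<^sub>C \<mu> \<in> dual"
  by (auto simp: dual_def clinear_iff scaleC_complex_def scaleC_fun_def algebra_simps)

section \<open>Modules over complex Lie algebras\<close>

text \<open>With \<open>bracket\<close> in place of \<open>act\<close> this gives iterated brackets,
  so modules and the algebra itself share one calculus of monomials.\<close>

definition word :: "('g \<Rightarrow> 'v \<Rightarrow> 'v) \<Rightarrow> ('i \<Rightarrow> 'g) \<Rightarrow> 'i list \<Rightarrow> 'v \<Rightarrow> 'v"
  where "word act x is v = foldr (\<lambda>i. act (x i)) is v"

lemma word_simps [simp]:
  "word act x [] v = v" "word act x (i # is) v = act (x i) (word act x is v)"
  "word act x (is @ js) v = word act x is (word act x js v)"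
  by (simp_all add: word_def)

locale lie_rep =
  fixes act :: "'g::complex_lie_algebra \<Rightarrow> 'v::complex_vector \<Rightarrow> 'v"
  assumes lie_module: "lie_module act"
begin

lemma act_clinear: "clinear (act x)" "clinear (\<lambda>x. act x v)"
  using lie_module by (auto simp: lie_module_def)

lemma act_simps [simp]:
  "act x (v + w) = act x v + act x w" "act x (c *\<^sub>C v) = c *\<^sub>C act x v"
  "act (x + y) v = act x v + act y v" "act (c *\<^sub>C x) v = c *\<^sub>C act x v"
  using act_clinear by (auto simp: clinear_iff)

lemma act_zero [simp]: "act x 0 = 0" "act 0 v = 0"
  using act_simps(2)[of x 0 0] act_simps(4)[of 0 0 v] by simp_all

lemma act_minus [simp]: "act x (- v) = - act x v" "act (- x) v = - act x v"
  using act_simps(2)[of x "-1" v] act_simps(4)[of "-1" x v] by simp_all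

lemma act_diff [simp]: "act x (v - w) = act x v - act x w" "act (x - y) v = act x v - act y v"
  using act_simps(1)[of x v "-w"] act_simps(3)[of x "-y" v] by simp_all

lemma act_bracket: "act (bracket x y) v = act x (act y v) - act y (act x v)"
  using lie_module by (auto simp: lie_module_def)

lemma act_commute: "act x (act y v) = act (bracket x y) v + act y (act x v)"
  by (simp add: act_bracket)

lemma act_span:
  assumes "\<And>v. v \<in> X \<Longrightarrow> act x v \<in> complex_vector.span Y" "v \<in> complex_vector.span X"
  shows "act x v \<in> complex_vector.span Y"
  using clinear_span[OF act_clinear(1)] assms by blast

lemma word_act_simps [simp]:
  "word act x is 0 = 0" "word act x is (v + w) = word act x is v + word act x is w"
  "word act x is (v - w) = word act x is v - word act x is w"
  "word act x is (c *\<^sub>C v) = c *\<^sub>C word act x is v"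
  by (induction "is") auto

lemma funpow_act_simps [simp]:
  "(act x ^^ n) 0 = 0" "(act x ^^ n) (v + w) = (act x ^^ n) v + (act x ^^ n) w"
  "(act x ^^ n) (c *\<^sub>C v) = c *\<^sub>C (act x ^^ n) v"
  by (induction n) auto

text \<open>A bracket acts as a commutator, so the elements preserving a fixed subspace form a Lie
  subalgebra.\<close>

lemma act_generated_closed:
  assumes W: "complex_vector.subspace W" and S: "\<And>x w. x \<in> S \<Longrightarrow> w \<in> W \<Longrightarrow> act x w \<in> W"
    and x: "x \<in> lie_generated S" and w: "w \<in> W"
  shows "act x w \<in> W"
proof -
  let ?L = "{x. \<forall>w\<in>W. act x w \<in> W}"
  have "lie_subalgebra ?L"
    unfolding lie_subalgebra_def complex_vector.subspace_def
    using W by (auto simp: act_bracket complex_vector.subspace_def complex_vector.subspace_diff)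
  then have "lie_generated S \<subseteq> ?L" using S by (auto simp: lie_generated_def)
  then show ?thesis using x w by auto
qed

section \<open>Weight vectors and their independence\<close>

lemma weight_spaceD: "v \<in> weight_space \<iota> act \<mu> \<Longrightarrow> act (\<iota> h) v = \<mu> h *\<^sub>C v"
  by (simp add: weight_space_def)

lemma weight_space_subspace: "complex_vector.subspace (weight_space \<iota> act \<mu>)"
  by (auto simp: complex_vector.subspace_def weight_space_def scaleC_add_right scaleC_scaleC mult.commute)

lemma weight_space_unique:
  assumes "v \<in> weight_space \<iota> act \<mu>" "v \<in> weight_space \<iota> act \<nu>" "v \<noteq> 0"
  shows "\<mu> = \<nu>"
  using assms by (force simp: weight_space_def)

lemma act_weight_space:
  assumes "x \<in> weight_space \<iota> bracket \<beta>" "v \<in> weight_space \<iota> act \<mu>"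
  shows "act x v \<in> weight_space \<iota> act (\<beta> + \<mu>)"
  using assms by (auto simp: weight_space_def act_commute[of "\<iota> _" x] scaleC_add_left)

lemma word_weight_space:
  assumes "\<And>i. x i \<in> weight_space \<iota> bracket (\<gamma> i)" "v \<in> weight_space \<iota> act \<mu>"
  shows "word act x is v \<in> weight_space \<iota> act (sum_list (map \<gamma> is) + \<mu>)"
  using assms(2) by (induction "is") (auto simp: add.assoc intro!: act_weight_space assms(1))

lemma funpow_weight_space:
  assumes "x \<in> weight_space \<iota> bracket \<beta>" "v \<in> weight_space \<iota> act \<mu>"
  shows "(act x ^^ n) v \<in> weight_space \<iota> act (of_nat n *\<^sub>C \<beta> + \<mu>)"
proof (induction n)
  case (Suc n)
  have "\<beta> + (of_nat n *\<^sub>C \<beta> + \<mu>) = of_nat (Suc n) *\<^sub>C \<beta> + \<mu>"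
    unfolding of_nat_Suc scaleC_add_left scaleC_one by (rule add.assoc[symmetric])
  then show ?case using act_weight_space[OF assms(1) Suc] by (simp only: funpow.simps o_apply)
qed (use assms(2) in simp)

text \<open>Independence of eigenvectors, by induction: for an \<open>h\<close> that separates the
  weight of \<open>y\<close> from \<mu>, the operator \<open>?g\<close> kills \<open>y\<close>,
  preserves the span of \<open>T\<close> and multiplies \<open>x\<close> by a nonzero
  scalar.\<close>

lemma weight_vector_notin_span:
  assumes "finite T" "\<And>y. y \<in> T \<Longrightarrow> \<exists>\<nu>. \<nu> \<noteq> \<mu> \<and> y \<in> weight_space \<iota> act \<nu>"
    and "x \<in> complex_vector.span T" "x \<in> weight_space \<iota> act \<mu>"
  shows "x = 0"
  using assms
proof (induction T arbitrary: x rule: finite_induct)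
  case (insert y T)
  from insert.prems(1)[of y] obtain \<nu> where \<nu>: "\<nu> \<noteq> \<mu>" "y \<in> weight_space \<iota> act \<nu>" by auto
  then obtain h where h: "\<nu> h \<noteq> \<mu> h" by auto
  let ?g = "\<lambda>x. act (\<iota> h) x - \<nu> h *\<^sub>C x"
  from insert.prems(2) obtain k where k: "x - k *\<^sub>C y \<in> complex_vector.span T"
    by (auto simp: complex_vector.span_insert)
  have "clinear ?g"
    by (simp add: clinear_iff scaleC_add_right complex_vector.scale_right_diff_distrib
        complex_vector.scale_left_commute)
  moreover have "?g z \<in> complex_vector.span T" if z: "z \<in> T" for z
  proof -
    obtain \<xi> where "z \<in> weight_space \<iota> act \<xi>" using insert.prems(1) z by auto
    then have "?g z = (\<xi> h - \<nu> h) *\<^sub>C z"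
      by (simp add: weight_spaceD complex_vector.scale_left_diff_distrib)
    then show ?thesis using z by (simp add: complex_vector.span_base complex_vector.span_scale)
  qed
  ultimately have "?g (x - k *\<^sub>C y) \<in> complex_vector.span T" using k by (rule clinear_span)
  moreover have "?g (x - k *\<^sub>C y) = (\<mu> h - \<nu> h) *\<^sub>C x"
    using weight_spaceD[OF \<nu>(2), of h] weight_spaceD[OF insert.prems(3), of h]
    by (simp add: complex_vector.scale_left_diff_distrib complex_vector.scale_right_diff_distrib
        complex_vector.scale_left_commute)
  ultimately have "(\<mu> h - \<nu> h) *\<^sub>C x = 0"
    using insert.prems(1,3) weight_space_subspace[of \<iota> \<mu>]
    by (intro insert.IH) (auto intro: complex_vector.subspace_scale)
  then show ?case using h by simp
qed auto

text \<open>This takes the place of a weight space decomposition: the occurring weights can be read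
  off any spanning set of weight vectors.\<close>

lemma weight_vector_in_span:
  assumes X: "\<And>y. y \<in> X \<Longrightarrow> \<exists>\<nu>. y \<in> weight_space \<iota> act \<nu>"
    and x: "x \<in> complex_vector.span X" "x \<in> weight_space \<iota> act \<mu>" "x \<noteq> 0"
  shows "\<exists>y\<in>X. y \<noteq> 0 \<and> y \<in> weight_space \<iota> act \<mu>"
proof (rule ccontr)
  assume none: "\<not> ?thesis"
  \<comment> \<open>The zero vector lies in every weight space, so it must go before the remaining
    vectors can be said not to have weight \<mu>.\<close>
  have "x \<in> complex_vector.span (X - {0})" using x(1) by simp
  then obtain T r where T: "finite T" "T \<subseteq> X - {0}" and r: "x = (\<Sum>a\<in>T. r a *\<^sub>C a)"
    unfolding complex_vector.span_explicit by blast
  have xT: "x \<in> complex_vector.span T"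
    by (subst r) (rule complex_vector.span_sum, rule complex_vector.span_scale,
        erule complex_vector.span_base)
  have "x = 0"
  proof (rule weight_vector_notin_span[OF T(1) _ xT x(2)])
    fix y assume "y \<in> T"
    then have y: "y \<in> X" "y \<noteq> 0" using T(2) by auto
    then have "y \<notin> weight_space \<iota> act \<mu>" using none by blast
    with X[OF y(1)] show "\<exists>\<nu>. \<nu> \<noteq> \<mu> \<and> y \<in> weight_space \<iota> act \<nu>" by metis
  qed
  with x(3) show False by simp
qed

text \<open>Leibniz rule: in each term of the expansion either at least \<open>m\<close> copies of
  \<open>x\<close> hit \<open>z\<close> or at least \<open>n\<close> copies hit \<open>y\<close>.
  The induction distributes one \<open>x\<close> at a time.\<close>

lemma funpow_act_in_submodule:
  assumes N: "submodule act N"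
  shows "(bracket x ^^ m) z = 0 \<Longrightarrow> (act x ^^ n) y \<in> N \<Longrightarrow> (act x ^^ (m + n)) (act z y) \<in> N"
proof (induction "m + n" arbitrary: m n z y)
  case 0
  then show ?case using N by (auto simp: submodule_def complex_vector.subspace_0)
next
  case (Suc k)
  have cl: "(act x ^^ j) w \<in> N" if "w \<in> N" for j w
    using N that by (induction j) (auto simp: submodule_def)
  show ?case
  proof (cases "m = 0 \<or> n = 0")
    case True
    then show ?thesis
    proof
      assume "n = 0"
      then have "act z y \<in> N" using Suc.prems N by (auto simp: submodule_def)
      then show ?thesis by (rule cl)
    qed (use Suc.prems N in \<open>auto simp: submodule_def complex_vector.subspace_0\<close>)
  next
    case False
    then obtain m' n' where mn: "m = Suc m'" "n = Suc n'" by (metis not0_implies_Suc)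
    have "(act x ^^ (m' + n)) (act (bracket x z) y) \<in> N"
      using Suc.hyps(1)[of m' n "bracket x z" y] Suc.hyps(2) Suc.prems
      by (simp add: mn funpow_swap1)
    moreover have "(act x ^^ (m + n')) (act z (act x y)) \<in> N"
      using Suc.hyps(1)[of m n' z "act x y"] Suc.hyps(2) Suc.prems
      by (simp add: mn funpow_swap1)
    ultimately have "(act x ^^ (m' + n)) (act (bracket x z) y + act z (act x y)) \<in> N"
      using N by (simp add: mn submodule_def complex_vector.subspace_add)
    moreover have "(act x ^^ (m + n)) (act z y) = (act x ^^ (m' + n)) (act x (act z y))"
      by (simp add: mn funpow_swap1)
    ultimately show ?thesis by (metis act_commute)
  qed
qed

section \<open>Strings through a singular vector of sl2\<close>

lemma sl2_string:
  assumes EF: "bracket E F = H" and HF: "bracket H F = - (2 *\<^sub>C F)"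
    and Ez: "act E z = 0" and Hz: "act H z = c *\<^sub>C z"
  shows "act H ((act F ^^ t) z) = (c - 2 * of_nat t) *\<^sub>C (act F ^^ t) z"
    and "act E ((act F ^^ Suc t) z) = (of_nat (Suc t) * (c - of_nat t)) *\<^sub>C (act F ^^ t) z"
proof -
  show H: "act H ((act F ^^ t) z) = (c - 2 * of_nat t) *\<^sub>C (act F ^^ t) z" for t
  proof (induction t)
    case (Suc t)
    have "act H ((act F ^^ Suc t) z) = - (2 *\<^sub>C (act F ^^ Suc t) z) + act F (act H ((act F ^^ t) z))"
      by (simp add: act_commute[of H F] HF)
    then show ?case
      by (simp add: Suc complex_vector.scale_left_diff_distrib complex_vector.scale_left_distrib algebra_simps)
  qed (simp add: Hz)
  show "act E ((act F ^^ Suc t) z) = (of_nat (Suc t) * (c - of_nat t)) *\<^sub>C (act F ^^ t) z"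
  proof (induction t)
    case 0
    show ?case by (simp add: act_commute[of E F] EF Ez Hz)
  next
    case (Suc t)
    let ?w = "(act F ^^ Suc t) z"
    have "act E ((act F ^^ Suc (Suc t)) z) = act H ?w + act F (act E ?w)"
      using act_commute[of E F ?w] by (simp add: EF)
    also have "\<dots> = (c - 2 * of_nat (Suc t)) *\<^sub>C ?w + (of_nat (Suc t) * (c - of_nat t)) *\<^sub>C ?w"
      unfolding Suc H act_simps by simp
    also have "\<dots> = (of_nat (Suc (Suc t)) * (c - of_nat (Suc t))) *\<^sub>C ?w"
      unfolding scaleC_add_left[symmetric] by (rule arg_cong[where f = "\<lambda>s. s *\<^sub>C ?w"]) (simp add: algebra_simps)
    finally show ?case .
  qed
qed

text \<open>The excluded values of \<open>c\<close> are the only zeros of the coefficients in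
  \<open>sl2_string\<close>, so \<open>E\<close> recovers a nonzero multiple of the preceding
  vector.\<close>

lemma sl2_string_nonzero:
  assumes sl2: "bracket E F = H" "bracket H F = - (2 *\<^sub>C F)" "act E z = 0" "act H z = c *\<^sub>C z"
    and z: "z \<noteq> 0" and c: "\<And>s. s < t \<Longrightarrow> c \<noteq> of_nat s"
  shows "(act F ^^ t) z \<noteq> 0"
  using c
proof (induction t)
  case (Suc t)
  then have "act E ((act F ^^ Suc t) z) \<noteq> 0"
    unfolding sl2_string(2)[OF sl2] by (simp del: of_nat_Suc)
  then show ?case by fastforce
qed (use z in simp)

lemma sl2_string_finite:
  assumes sl2: "bracket E F = H" "bracket H F = - (2 *\<^sub>C F)" "act E z = 0" "act H z = c *\<^sub>C z"
    and z: "z \<noteq> 0" and n: "(act F ^^ n) z = 0"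
  obtains m where "c = of_nat m" "(act F ^^ m) z \<noteq> 0"
proof -
  obtain m where m: "c = of_nat m" using sl2_string_nonzero[OF sl2 z, of n] n by blast
  then show thesis using that sl2_string_nonzero[OF sl2 z, of m] by simp
qed

text \<open>Together with exchanging \<open>e\<close> and \<open>f\<close>, negating the embedding
  transfers results between raising and lowering operators.\<close>

lemma weight_space_uminus: "weight_space (\<lambda>h. - \<iota> h) act \<mu> = weight_space \<iota> act (- \<mu>)"
  by (simp add: weight_space_def minus_equation_iff[of "act _ _"] eq_commute[of "- _" "act _ _"])

lemma wtI: "v \<in> weight_space \<iota> act \<mu> \<Longrightarrow> v \<noteq> 0 \<Longrightarrow> \<mu> \<in> dual \<Longrightarrow> \<mu> \<in> wt \<iota> act"
  by (auto simp: wt_def)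

lemma wtE:
  assumes "\<mu> \<in> wt \<iota> act"
  obtains v where "v \<in> weight_space \<iota> act \<mu>" "v \<noteq> 0" "\<mu> \<in> dual"
  using assms complex_vector.subspace_0[OF weight_space_subspace, of \<iota> \<mu>] that by (auto simp: wt_def)

end

lemma bracket_anti: "bracket x y = - bracket y (x :: 'g::complex_lie_algebra)"
proof -
  have "bracket x y + bracket y x = bracket (x + y) (x + y)"
    by (simp only: bracket_add_left bracket_add_right) (simp add: bracket_self)
  then have "bracket x y + bracket y x = 0" by (simp only: bracket_self)
  then show ?thesis by (simp add: eq_neg_iff_add_eq_0)
qed

lemma adjoint_rep: "lie_rep (bracket :: 'g::complex_lie_algebra \<Rightarrow> 'g \<Rightarrow> 'g)"
proof
  have "bracket (bracket x y) z = bracket x (bracket y z) - bracket y (bracket x z)" for x y z :: 'g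
  proof -
    have "bracket x (bracket y z) + bracket y (bracket z x) + bracket z (bracket x y) = 0"
      by (rule jacobi)
    moreover have "bracket y (bracket z x) = - bracket y (bracket x z)"
      using bracket_scaleC_right[of y "-1" "bracket x z"] bracket_anti[of z x] by simp
    ultimately show ?thesis
      by (simp add: bracket_anti[of "bracket x y" z] add_eq_0_iff)
  qed
  then show "lie_module (bracket :: 'g \<Rightarrow> 'g \<Rightarrow> 'g)"
    by (simp add: lie_module_def clinear_iff bracket_add_left bracket_add_right
        bracket_scaleC_left bracket_scaleC_right)
qed

interpretation adj: lie_rep "bracket :: 'g::complex_lie_algebra \<Rightarrow> 'g \<Rightarrow> 'g"
  by (rule adjoint_rep)

section \<open>The Chevalley relations\<close>

text \<open>The bare relations are kept apart from generation and \<open>no_ideal\<close> because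
  \<open>e_word_zero\<close> also interprets them in a product algebra.\<close>

locale chevalley =
  fixes coroot :: "'i \<Rightarrow> 'h::complex_vector"
    and \<alpha> :: "'i \<Rightarrow> 'h \<Rightarrow> complex"
    and \<iota> :: "'h \<Rightarrow> 'g::complex_lie_algebra"
    and e f :: "'i \<Rightarrow> 'g"
  assumes embedding_linear: "clinear \<iota>"
    and embedding_abelian: "bracket (\<iota> h) (\<iota> h') = 0"
    and rel_e_f: "bracket (e i) (f j) = (if i = j then \<iota> (coroot i) else 0)"
    and rel_h_e: "bracket (\<iota> h) (e i) = \<alpha> i h *\<^sub>C e i"
    and rel_h_f: "bracket (\<iota> h) (f i) = - (\<alpha> i h *\<^sub>C f i)"
begin

lemma e_weight: "e i \<in> weight_space \<iota> bracket (\<alpha> i)"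
  and f_weight: "f i \<in> weight_space \<iota> bracket (- \<alpha> i)"
  and h_weight: "\<iota> h \<in> weight_space \<iota> bracket 0"
  by (simp_all add: weight_space_def rel_h_e rel_h_f embedding_abelian)

lemma \<iota>_simps: "\<iota> (h + h') = \<iota> h + \<iota> h'" "\<iota> (c *\<^sub>C h) = c *\<^sub>C \<iota> h" "\<iota> (- h) = - \<iota> h" "\<iota> 0 = 0"
proof -
  show *: "\<iota> (h + h') = \<iota> h + \<iota> h'" "\<iota> (c *\<^sub>C h) = c *\<^sub>C \<iota> h" for h h' c
    using embedding_linear by (auto simp: clinear_iff)
  show "\<iota> (- h) = - \<iota> h" "\<iota> 0 = 0" using *(2)[of "-1" h] *(2)[of 0 0] by simp_all
qed

text \<open>The Chevalley involution at the level of the relations: negating \<open>\<iota>\<close>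
  absorbs the sign in the bracket of \<open>f i\<close> with \<open>e i\<close>.\<close>

lemma swap: "chevalley coroot \<alpha> (\<lambda>h. - \<iota> h) f e"
  by unfold_locales
    (auto simp: \<iota>_simps clinear_iff embedding_abelian rel_h_e rel_h_f bracket_anti[of "f _" "e _"] rel_e_f)

lemma range_uminus_\<iota>: "range (\<lambda>h. - \<iota> h) = range \<iota>"
  by (auto simp flip: \<iota>_simps(3)) (metis add.inverse_inverse \<iota>_simps(3) rangeI)

section \<open>The spanning set behind the triangular decomposition\<close>

definition "tri = range \<iota> \<union> {word bracket e is (e k) | is k. True} \<union> {word bracket f is (f k) | is k. True}"

lemma e_word_weight: "word bracket e is (e k) \<in> weight_space \<iota> bracket (sum_list (map \<alpha> (is @ [k])))"
  using adj.word_weight_space[where x = e and \<gamma> = \<alpha>, OF e_weight e_weight] by simp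

lemma f_word_weight: "word bracket f is (f k) \<in> weight_space \<iota> bracket (- sum_list (map \<alpha> (is @ [k])))"
proof -
  interpret sw: chevalley coroot \<alpha> "\<lambda>h. - \<iota> h" f e by (rule swap)
  from sw.e_word_weight show ?thesis unfolding adj.weight_space_uminus .
qed

lemma tri_weight: "x \<in> tri \<Longrightarrow> \<exists>\<nu>. x \<in> weight_space \<iota> bracket \<nu>"
  unfolding tri_def using e_word_weight f_word_weight h_weight by blast

lemma tri_h: "x \<in> complex_vector.span tri \<Longrightarrow> bracket (\<iota> h) x \<in> complex_vector.span tri"
  by (erule adj.act_span[rotated])
    (metis tri_weight adj.weight_spaceD complex_vector.span_base complex_vector.span_scale)

text \<open>The delicate case is \<open>e j\<close> on a word in the \<open>f\<close>. It is
  commuted past the letters, and each commutator is zero or a coroot, which acts on the rest of the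
  word by a scalar.\<close>

lemma tri_e:
  assumes "x \<in> complex_vector.span tri"
  shows "bracket (e j) x \<in> complex_vector.span tri"
proof (rule adj.act_span[OF _ assms])
  note base = complex_vector.span_base[of _ tri]
  have ew: "word bracket e is (e k) \<in> complex_vector.span tri" for "is" k
    by (rule base) (auto simp: tri_def)
  have h: "\<iota> h \<in> complex_vector.span tri" for h
    by (rule base) (auto simp: tri_def)
  \<comment> \<open>The Cartan part is included because the bracket of \<open>e j\<close> with the
    single letter \<open>f j\<close> lands there.\<close>
  let ?Y = "range \<iota> \<union> {word bracket f is (f k) | is k. True}"
  have fY: "bracket (f i) y \<in> complex_vector.span ?Y" if "y \<in> complex_vector.span ?Y" for i y
  proof (rule adj.act_span[OF _ that])
    fix v assume "v \<in> ?Y"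
    then show "bracket (f i) v \<in> complex_vector.span ?Y"
    proof safe
      fix h
      have "f i \<in> complex_vector.span ?Y"
        by (rule complex_vector.span_base) (metis (mono_tags, lifting) UnI2 mem_Collect_eq word_simps(1))
      then show "bracket (f i) (\<iota> h) \<in> complex_vector.span ?Y"
        by (simp add: bracket_anti[of "f i"] rel_h_f complex_vector.span_scale)
    next
      fix js k
      show "bracket (f i) (word bracket f js (f k)) \<in> complex_vector.span ?Y"
        by (rule complex_vector.span_base) (metis (mono_tags, lifting) UnI2 mem_Collect_eq word_simps(2))
    qed
  qed
  have fw: "bracket (e j) (word bracket f is (f k)) \<in> complex_vector.span ?Y" for "is" k
  proof (induction "is")
    case Nil
    then show ?case by (auto simp: rel_e_f complex_vector.span_base complex_vector.span_zero)
  next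
    case (Cons i js)
    let ?y = "word bracket f js (f k)"
    have "?y \<in> complex_vector.span ?Y" by (rule complex_vector.span_base) blast
    then have "bracket (\<iota> (coroot i)) ?y \<in> complex_vector.span ?Y"
      unfolding adj.weight_spaceD[OF f_word_weight] by (rule complex_vector.span_scale)
    then have "bracket (bracket (e j) (f i)) ?y \<in> complex_vector.span ?Y"
      by (auto simp: rel_e_f complex_vector.span_zero)
    then show ?case
      using fY[OF Cons, of i] adj.act_commute[of "e j" "f i" ?y]
      by (simp add: complex_vector.span_add)
  qed
  have "?Y \<subseteq> tri" by (auto simp: tri_def)
  then have sub: "complex_vector.span ?Y \<subseteq> complex_vector.span tri"
    by (rule complex_vector.span_mono)
  fix v assume "v \<in> tri"
  then consider h where "v = \<iota> h" | js k where "v = word bracket e js (e k)"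
    | js k where "v = word bracket f js (f k)"
    unfolding tri_def by blast
  then show "bracket (e j) v \<in> complex_vector.span tri"
  proof cases
    case 1
    then show ?thesis using ew[of "[]" j]
      by (simp add: bracket_anti[of "e j"] rel_h_e complex_vector.span_scale complex_vector.span_neg)
  next
    case (2 js k)
    then show ?thesis using ew[of "j # js" k] by simp
  next
    case 3
    then show ?thesis using fw sub by auto
  qed
qed

lemma tri_generated:
  assumes "z \<in> lie_generated (range \<iota> \<union> range e \<union> range f)" "x \<in> complex_vector.span tri"
  shows "bracket z x \<in> complex_vector.span tri"
proof -
  interpret sw: chevalley coroot \<alpha> "\<lambda>h. - \<iota> h" f e by (rule swap)
  \<comment> \<open>\<open>tri\<close> is its own mirror image, so stability under the
    \<open>f j\<close> follows from stability under the \<open>e j\<close>.\<close>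
  have "sw.tri = tri" by (auto simp: sw.tri_def tri_def range_uminus_\<iota>)
  then have "bracket (f j) x \<in> complex_vector.span tri" if "x \<in> complex_vector.span tri" for j x
    using sw.tri_e that by simp
  then show ?thesis
    using adj.act_generated_closed[OF complex_vector.subspace_span _ assms] tri_e tri_h by blast
qed

end

section \<open>The root lattice\<close>

lemma sum_list_replicate_scaleC: "sum_list (replicate n x) = of_nat n *\<^sub>C (x :: 'a::complex_vector)"
  by (induction n) (simp_all add: scaleC_add_left scaleC_one)

lemma sum_list_count:
  assumes "finite T" "set bs \<subseteq> T"
  shows "sum_list bs = (\<Sum>s\<in>T. of_nat (count_list bs s) *\<^sub>C (s :: 'a::complex_vector))"
  using assms(2)
proof (induction bs)
  case (Cons b bs)
  have "(\<Sum>s\<in>T. of_nat (count_list (b # bs) s) *\<^sub>C s)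
      = (\<Sum>s\<in>T. (if b = s then s else 0) + of_nat (count_list bs s) *\<^sub>C s)"
    by (intro sum.cong) (auto simp: scaleC_add_left scaleC_one)
  also have "\<dots> = b + (\<Sum>s\<in>T. of_nat (count_list bs s) *\<^sub>C s)"
    using Cons.prems assms(1) by (simp add: sum.distrib)
  finally show ?case using Cons by simp
qed simp

text \<open>Multiplicities become repetitions in a list, which permits induction on the number of
  summands.\<close>

lemma nat_combs_eq: "nat_combs S = {sum_list bs | bs. set bs \<subseteq> (S :: 'a::complex_vector set)}"
proof (intro set_eqI iffI)
  fix x assume "x \<in> nat_combs S"
  then obtain T n where T: "finite T" "T \<subseteq> S" and x: "x = (\<Sum>s\<in>T. of_nat (n s) *\<^sub>C s)"
    by (auto simp: nat_combs_def)
  from T have "\<exists>bs. set bs \<subseteq> S \<and> sum_list bs = (\<Sum>s\<in>T. of_nat (n s) *\<^sub>C s)"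
  proof (induction T rule: finite_induct)
    case (insert s T)
    then obtain bs where "set bs \<subseteq> S" "sum_list bs = (\<Sum>s\<in>T. of_nat (n s) *\<^sub>C s)" by auto
    then have "set (replicate (n s) s @ bs) \<subseteq> S"
        "sum_list (replicate (n s) s @ bs) = (\<Sum>s\<in>insert s T. of_nat (n s) *\<^sub>C s)"
      using insert by (auto simp: sum_list_replicate_scaleC)
    then show ?case by blast
  qed (auto intro: exI[of _ "[]"])
  with x show "x \<in> {sum_list bs | bs. set bs \<subseteq> S}"
    by (metis (mono_tags, lifting) mem_Collect_eq)
next
  fix x assume "x \<in> {sum_list bs | bs. set bs \<subseteq> S}"
  then obtain bs where "x = sum_list bs" "set bs \<subseteq> S" by auto
  then show "x \<in> nat_combs S"
    unfolding nat_combs_def using sum_list_count[of "set bs" bs] by blast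
qed

lemma nat_combs_image: "nat_combs (\<alpha> ` J) = {sum_list (map \<alpha> is) | is. set is \<subseteq> J}"
proof -
  have "{bs. set bs \<subseteq> \<alpha> ` J} = map \<alpha> ` {is. set is \<subseteq> J}"
    using lists_image[of \<alpha> J] by (simp add: lists_eq_set)
  then have "sum_list ` {bs. set bs \<subseteq> \<alpha> ` J} = (\<lambda>is. sum_list (map \<alpha> is)) ` {is. set is \<subseteq> J}"
    by (simp add: image_image)
  then show ?thesis unfolding nat_combs_eq by (simp only: setcompr_eq_image)
qed

lemma minkowski_diff_iff: "x \<in> C \<ominus> D \<longleftrightarrow> (\<exists>c\<in>C. \<exists>d\<in>D. x = c - d)"
  by (auto simp: minkowski_diff_def)

text \<open>Integer coordinates cover differences and negative roots too; \<open>rt_inj\<close>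
  later turns equations between weights into equations between coordinates.\<close>

definition rt :: "('i::finite \<Rightarrow> 'h \<Rightarrow> complex) \<Rightarrow> ('i \<Rightarrow> int) \<Rightarrow> 'h \<Rightarrow> complex"
  where "rt \<alpha> n = (\<Sum>k\<in>UNIV. of_int (n k) *\<^sub>C \<alpha> k)"

lemma rt_add: "rt \<alpha> (\<lambda>i. m i + n i) = rt \<alpha> m + rt \<alpha> n"
  and rt_diff: "rt \<alpha> (\<lambda>i. m i - n i) = rt \<alpha> m - rt \<alpha> n"
  and rt_uminus: "rt \<alpha> (\<lambda>i. - n i) = - rt \<alpha> n"
  by (simp_all add: rt_def complex_vector.scale_left_distrib complex_vector.scale_left_diff_distrib
      sum.distrib sum_subtractf sum_negf)

lemma rt_single: "rt \<alpha> (\<lambda>i. if i = j then c else 0) = of_int c *\<^sub>C \<alpha> j"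
  by (simp add: rt_def if_distrib[of of_int] if_distrib[of "\<lambda>c. c *\<^sub>C _"] cong: if_cong)

lemma sum_list_eq_rt: "sum_list (map \<alpha> is) = rt \<alpha> (\<lambda>i. int (count_list is i))"
proof (induction "is")
  case (Cons j js)
  have "(\<lambda>i. int (count_list (j # js) i)) = (\<lambda>i. (if i = j then 1 else 0) + int (count_list js i))"
    by auto
  then show ?case unfolding Cons.IH[symmetric] by (simp add: rt_add rt_single scaleC_one Cons.IH)
qed (simp add: rt_def)

context realization
begin

lemma root_coordinates_unique:
  assumes "(\<Sum>k\<in>UNIV. c k *\<^sub>C \<alpha> k) = (\<Sum>k\<in>UNIV. d k *\<^sub>C \<alpha> k)"
  shows "c = d"
proof
  fix i
  let ?u = "\<lambda>x. c (inv \<alpha> x) - d (inv \<alpha> x)"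
  have "(\<Sum>x\<in>range \<alpha>. ?u x *\<^sub>C x) = (\<Sum>k\<in>UNIV. c k *\<^sub>C \<alpha> k) - (\<Sum>k\<in>UNIV. d k *\<^sub>C \<alpha> k)"
    using roots_indep(1)
    by (subst sum.reindex) (auto simp: sum_subtractf complex_vector.scale_left_diff_distrib)
  then have "(\<Sum>x\<in>range \<alpha>. ?u x *\<^sub>C x) = 0" using assms by simp
  from complex_vector.independentD[OF roots_indep(2) _ subset_refl this, of "\<alpha> i"]
  show "c i = d i" using roots_indep(1) by simp
qed

lemma rt_inj: "rt \<alpha> m = rt \<alpha> n \<longleftrightarrow> m = n"
  using root_coordinates_unique[of "\<lambda>k. of_int (m k)" "\<lambda>k. of_int (n k)"]
  by (auto simp: rt_def fun_eq_iff)

lemma rt_eq_0: "rt \<alpha> n = 0 \<longleftrightarrow> n = (\<lambda>_. 0)"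
  using rt_inj[of n "\<lambda>_. 0"] by (simp add: rt_def)

lemma sum_list_roots_eq_iff:
  "sum_list (map \<alpha> is) = sum_list (map \<alpha> js) \<longleftrightarrow> count_list is = count_list js"
  unfolding sum_list_eq_rt rt_inj by (simp add: fun_eq_iff)

lemma sum_list_roots_eqD:
  "sum_list (map \<alpha> is) = sum_list (map \<alpha> js) \<Longrightarrow> set is = set js"
  unfolding sum_list_roots_eq_iff by (metis count_list_0_iff subsetI subset_antisym)

lemma sum_list_roots_nonzero: "is \<noteq> [] \<Longrightarrow> sum_list (map \<alpha> is) \<noteq> 0"
  using sum_list_roots_eqD[of "is" "[]"] by auto

text \<open>Uniqueness of the coordinates evaluates the definite description in
  \<open>ht\<close>.\<close>

lemma ht_rt: "ht \<alpha> J (rt \<alpha> n) = of_int (\<Sum>i\<in>J. n i)"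
proof -
  have "(THE c. rt \<alpha> n = (\<Sum>k\<in>UNIV. c k *\<^sub>C \<alpha> k)) = (\<lambda>k. of_int (n k))"
    using root_coordinates_unique by (intro the_equality) (auto simp: rt_def)
  then show ?thesis by (simp add: ht_def)
qed

lemma rt_dual: "rt \<alpha> n \<in> dual"
proof -
  have "(\<Sum>k\<in>S. of_int (n k) *\<^sub>C \<alpha> k) \<in> dual" for S
    by (induction S rule: infinite_finite_induct)
      (simp_all only: sum.infinite sum.empty sum.insert dual_closed root_dual not_False_eq_True)
  then show ?thesis by (simp add: rt_def)
qed

lemma sum_apply: "(\<Sum>k\<in>S. g k) x = (\<Sum>k\<in>S. g k x)"
  by (induction S rule: infinite_finite_induct) auto

lemma rt_coroot: "rt \<alpha> n (coroot j) = of_int (\<Sum>k\<in>UNIV. n k * A $ j $ k)"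
  by (simp add: rt_def scaleC_fun_def scaleC_complex_def pairing sum_apply)

lemma rt_int_combs: "rt \<alpha> n \<in> int_combs (\<alpha> ` J) \<longleftrightarrow> (\<forall>i. i \<notin> J \<longrightarrow> n i = 0)"
proof
  assume "rt \<alpha> n \<in> int_combs (\<alpha> ` J)"
  then obtain T m where "T \<subseteq> \<alpha> ` J" and n: "rt \<alpha> n = (\<Sum>s\<in>T. of_int (m s) *\<^sub>C s)"
    by (auto simp: int_combs_def)
  then obtain I where I: "I \<subseteq> J" "T = \<alpha> ` I" by (auto elim: subset_imageE)
  have "(\<Sum>s\<in>T. of_int (m s) *\<^sub>C s) = (\<Sum>k\<in>I. of_int (m (\<alpha> k)) *\<^sub>C \<alpha> k)"
    using roots_indep(1) unfolding I(2) by (subst sum.reindex) (auto intro: inj_on_subset)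
  also have "\<dots> = rt \<alpha> (\<lambda>k. if k \<in> I then m (\<alpha> k) else 0)"
    unfolding rt_def by (intro sum.mono_neutral_cong_left) auto
  finally have "n = (\<lambda>k. if k \<in> I then m (\<alpha> k) else 0)" using n rt_inj by simp
  then show "\<forall>i. i \<notin> J \<longrightarrow> n i = 0" using I(1) by auto
next
  assume n: "\<forall>i. i \<notin> J \<longrightarrow> n i = 0"
  have "rt \<alpha> n = (\<Sum>k\<in>J. of_int (n k) *\<^sub>C \<alpha> k)"
    unfolding rt_def using n by (intro sum.mono_neutral_right) auto
  also have "\<dots> = (\<Sum>s\<in>\<alpha> ` J. of_int (n (inv \<alpha> s)) *\<^sub>C s)"
    using roots_indep(1) by (subst sum.reindex) (auto simp: inj_on_def)
  finally show "rt \<alpha> n \<in> int_combs (\<alpha> ` J)" 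
    unfolding int_combs_def
    by (intro CollectI exI[of _ "\<alpha> ` J"] exI[of _ "\<lambda>s. n (inv \<alpha> s)"]) simp
qed

end

section \<open>The adjoint representation of a Kac--Moody algebra\<close>

instantiation prod :: (complex_vector, complex_vector) complex_vector
begin
definition scaleC_prod_def: "a *\<^sub>C x = (a *\<^sub>C fst x, a *\<^sub>C snd x)"
instance
  by standard (simp_all add: scaleC_prod_def prod_eq_iff scaleC_add_right scaleC_add_left
      scaleC_scaleC scaleC_one)
end

text \<open>The graph of the Chevalley involution lives in this product; see
  \<open>e_word_zero\<close>.\<close>

instantiation prod :: (complex_lie_algebra, complex_lie_algebra) complex_lie_algebra
begin
definition bracket_prod_def: "bracket x y = (bracket (fst x) (fst y), bracket (snd x) (snd y))"
instance
  by standard (simp_all add: bracket_prod_def scaleC_prod_def prod_eq_iff bracket_self jacobi)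
end

lemma word_prod:
  "word bracket (\<lambda>i. (x i, y i)) is (v, w) = (word bracket x is v, word bracket y is w)"
  by (induction "is") (simp_all add: bracket_prod_def)

lemma lie_generated_induct:
  assumes "x \<in> lie_generated S" "lie_subalgebra {x. P x}" "\<And>x. x \<in> S \<Longrightarrow> P x"
  shows "P x"
  using assms by (auto simp: lie_generated_def)

lemma lie_generated_base: "x \<in> S \<Longrightarrow> x \<in> lie_generated S"
  by (auto simp: lie_generated_def)

lemma lie_subalgebra_generated: "lie_subalgebra (lie_generated S)"
  by (auto simp: lie_generated_def lie_subalgebra_def complex_vector.subspace_def)

context kac_moody_algebra
begin

sublocale chevalley coroot \<alpha> \<iota> e f
  by (rule chevalley.intro) (rule cartan_linear cartan_abelian bracket_e_f bracket_h_e bracket_h_f)+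

text \<open>The defining conditions survive the exchange since the image of the Cartan subalgebra is
  unchanged, so each result on the \<open>e i\<close> has a mirror image on the
  \<open>f i\<close>.\<close>

lemma swap_kac_moody: "kac_moody_algebra A coroot \<alpha> (\<lambda>h. - \<iota> h) f e"
proof -
  interpret sw: chevalley coroot \<alpha> "\<lambda>h. - \<iota> h" f e by (rule swap)
  show ?thesis
  proof (intro kac_moody_algebra.intro kac_moody_algebra_axioms.intro)
    show "inj (\<lambda>h. - \<iota> h)" using cartan_inj by (simp add: inj_on_def)
    show "lie_generated (range (\<lambda>h. - \<iota> h) \<union> range f \<union> range e) = UNIV"
      using generated unfolding range_uminus_\<iota> by (simp add: Un_ac)
    show "L = {0}" if "lie_ideal L" "L \<inter> range (\<lambda>h. - \<iota> h) = {0}" for L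
      using no_ideal that unfolding range_uminus_\<iota> by blast
  qed (rule realization_axioms sw.embedding_linear sw.embedding_abelian sw.rel_e_f sw.rel_h_e sw.rel_h_f)+
qed

lemma in_generated: "x \<in> lie_generated (range \<iota> \<union> range e \<union> range f)"
  by (simp add: generated)

text \<open>The span is stable under the whole algebra, hence a subalgebra, and it contains the
  generators.\<close>

lemma span_tri: "complex_vector.span tri = UNIV"
proof -
  have gen: "range \<iota> \<union> range e \<union> range f \<subseteq> complex_vector.span tri"
  proof -
    have "word bracket e [] (e k) \<in> tri" "word bracket f [] (f k) \<in> tri" for k
      unfolding tri_def by blast+
    then have "range \<iota> \<union> range e \<union> range f \<subseteq> tri" by (auto simp: tri_def)
    then show ?thesis using complex_vector.span_superset by blast
  qed
  have "lie_subalgebra (complex_vector.span tri)"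
    by (auto simp: lie_subalgebra_def complex_vector.subspace_span intro: tri_generated[OF in_generated])
  then have "lie_generated (range \<iota> \<union> range e \<union> range f) \<subseteq> complex_vector.span tri"
    using gen by (auto simp: lie_generated_def)
  then show ?thesis using generated by auto
qed

text \<open>By \<open>weight_vector_in_span\<close> the weight \<beta> occurs on a nonzero member of
  \<open>tri\<close>, and the weights of those are explicit. The nonzero word is kept as a concrete
  root vector.\<close>

lemma root_space_cases:
  assumes "x \<in> weight_space \<iota> bracket \<beta>" "x \<noteq> 0"
  obtains (zero) "\<beta> = 0"
    | (pos) "is" k where "\<beta> = sum_list (map \<alpha> (is @ [k]))" "word bracket e is (e k) \<noteq> 0"
    | (neg) "is" k where "\<beta> = - sum_list (map \<alpha> (is @ [k]))" "word bracket f is (f k) \<noteq> 0"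
proof -
  obtain y where y: "y \<in> tri" "y \<noteq> 0" "y \<in> weight_space \<iota> bracket \<beta>"
    using adj.weight_vector_in_span[OF tri_weight _ assms] span_tri by auto
  note u = adj.weight_space_unique[OF y(3) _ y(2)]
  from y(1) consider h where "y = \<iota> h" | js k where "y = word bracket e js (e k)"
    | js k where "y = word bracket f js (f k)"
    unfolding tri_def by blast
  then show thesis
  proof cases
    case 1
    then show ?thesis using u[of 0] h_weight zero by simp
  next
    case (2 js k)
    then show ?thesis using u e_word_weight y(2) pos by metis
  next
    case (3 js k)
    then show ?thesis using u f_word_weight y(2) neg by metis
  qed
qed

lemma roots_in_lattice:
  assumes "\<beta> \<in> wt \<iota> bracket"
  obtains n where "\<beta> = rt \<alpha> n" "(\<forall>i. n i \<ge> 0) \<or> (\<forall>i. n i \<le> 0)"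
proof -
  obtain x where x: "x \<in> weight_space \<iota> bracket \<beta>" "x \<noteq> 0"
    using assms by (rule adj.wtE)
  note n = that
  from x show ?thesis
  proof (cases rule: root_space_cases)
    case zero
    then show ?thesis using n[of "\<lambda>_. 0"] by (simp add: rt_def)
  next
    case (pos js k)
    then show ?thesis using n unfolding sum_list_eq_rt by (metis of_nat_0_le_iff)
  next
    case (neg js k)
    then show ?thesis
      using n[of "\<lambda>i. - int (count_list (js @ [k]) i)"] unfolding sum_list_eq_rt rt_uminus by simp
  qed
qed

text \<open>Commuting \<open>e i\<close> through a word leaves coroot terms, which act by scalars,
  until it kills \<open>v\<close>. The general \<open>act\<close> serves both highest weight modules
  and ideals of the algebra.\<close>

lemma word_ideal:
  assumes "lie_rep act" and v: "v \<in> weight_space \<iota> act \<mu>" "\<And>i. act (e i) v = 0"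
    and w: "w \<in> complex_vector.span {word act f is v | is. True}" (is "_ \<in> complex_vector.span ?X")
  shows "act x w \<in> complex_vector.span ?X"
proof -
  interpret lie_rep act by fact
  have wt: "word act f is v \<in> weight_space \<iota> act (sum_list (map (\<lambda>i. - \<alpha> i) is) + \<mu>)" for "is"
    by (rule word_weight_space[where x = f, OF f_weight v(1)])
  have base: "word act f is v \<in> complex_vector.span ?X" for "is"
    by (rule complex_vector.span_base) blast
  have h: "act (\<iota> h) (word act f is v) \<in> complex_vector.span ?X" for h "is"
    unfolding weight_spaceD[OF wt] by (rule complex_vector.span_scale) (rule base)
  have f: "act (f i) y \<in> complex_vector.span ?X" if "y \<in> complex_vector.span ?X" for i y
    using that
  proof (rule act_span[rotated])
    fix u assume "u \<in> ?X"
    then obtain js where "u = word act f js v" by blast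
    then show "act (f i) u \<in> complex_vector.span ?X" using base[of "i # js"] by simp
  qed
  have e: "act (e i) (word act f is v) \<in> complex_vector.span ?X" for i "is"
  proof (induction "is")
    case Nil
    then show ?case by (simp add: v complex_vector.span_zero)
  next
    case (Cons j js)
    have "act (bracket (e i) (f j)) (word act f js v) \<in> complex_vector.span ?X"
      using h by (auto simp: bracket_e_f complex_vector.span_zero)
    then show ?case using f[OF Cons, of j]
      by (simp add: act_commute[of "e i" "f j"] complex_vector.span_add)
  qed
  show ?thesis
  proof (rule act_generated_closed[OF complex_vector.subspace_span _ in_generated w])
    fix z y assume z: "z \<in> range \<iota> \<union> range e \<union> range f" and y: "y \<in> complex_vector.span ?X"
    show "act z y \<in> complex_vector.span ?X"
    proof (rule act_span[OF _ y])
      fix u assume "u \<in> ?X"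
      then show "act z u \<in> complex_vector.span ?X" using z h e f[OF base] by auto
    qed
  qed
qed

text \<open>A singular vector of negative weight generates an ideal with only negative weights,
  which therefore misses the Cartan subalgebra and vanishes by \<open>no_ideal\<close>.\<close>

lemma maximal_f_word_zero:
  assumes "\<And>i. bracket (e i) (word bracket f js (f k)) = 0"
  shows "word bracket f js (f k) = 0"
proof -
  let ?\<theta> = "word bracket f js (f k)"
  let ?L = "complex_vector.span {word bracket f is ?\<theta> | is. True}"
  have "lie_ideal ?L"
    unfolding lie_ideal_def
    using word_ideal[OF adj.lie_rep_axioms f_word_weight assms] complex_vector.subspace_span by blast
  moreover have "\<iota> h = 0" if h: "\<iota> h \<in> ?L" for h
  proof (rule ccontr)
    assume "\<iota> h \<noteq> 0"
    have wt: "word bracket f is ?\<theta> \<in> weight_space \<iota> bracket (- sum_list (map \<alpha> ((is @ js) @ [k])))" for "is"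
      using f_word_weight[of "is @ js" k] by simp
    have "\<exists>y\<in>{word bracket f is ?\<theta> | is. True}. y \<noteq> 0 \<and> y \<in> weight_space \<iota> bracket 0"
      using h h_weight \<open>\<iota> h \<noteq> 0\<close> wt by (intro adj.weight_vector_in_span) blast+
    then obtain js' where y: "word bracket f js' ?\<theta> \<in> weight_space \<iota> bracket 0" "word bracket f js' ?\<theta> \<noteq> 0"
      by blast
    have "0 = - sum_list (map \<alpha> ((js' @ js) @ [k]))"
      using y(1) wt y(2) by (rule adj.weight_space_unique)
    then show False
      using sum_list_roots_nonzero[of "(js' @ js) @ [k]"] by (metis neg_0_equal_iff_equal snoc_eq_iff_butlast)
  qed
  then have "?L \<inter> range \<iota> = {0}"
    using \<iota>_simps(4) by (auto simp: complex_vector.span_zero)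
  ultimately have "?L = {0}" by (rule no_ideal)
  moreover have "word bracket f [] ?\<theta> \<in> ?L" by (rule complex_vector.span_base) blast
  ultimately show ?thesis by simp
qed

section \<open>Serre relations and local nilpotency\<close>

lemma word_replicate: "word act x (replicate n i) v = (act (x i) ^^ n) v"
  by (induction n) auto

lemma f_sl2: "bracket (e i) (f i) = \<iota> (coroot i)"
    "bracket (\<iota> (coroot i)) (f i) = - (2 *\<^sub>C f i)"
  by (simp_all add: bracket_e_f bracket_h_f pairing diag)

text \<open>The vector \<open>?\<theta>\<close> is killed by every \<open>e k\<close>: for
  \<open>k = i\<close> by the sl2 formula, for \<open>k = j\<close> because \<open>f i\<close>
  brackets a coroot into a multiple of itself, otherwise because \<open>e k\<close> commutes with
  both letters. Then \<open>maximal_f_word_zero\<close> applies.\<close>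

lemma serre:
  assumes "i \<noteq> j"
  shows "\<exists>n. (bracket (f i) ^^ n) (f j) = 0"
proof -
  define m where "m = nat (- A $ i $ j)"
  have Am: "A $ i $ j = - int m" using off_diag[OF assms] by (simp add: m_def)
  let ?\<theta> = "(bracket (f i) ^^ Suc m) (f j)"
  have "bracket (e k) ?\<theta> = 0" for k
  proof (cases "k = i")
    case True
    have "bracket (e i) ?\<theta> = (of_nat (Suc m) * (of_nat m - of_nat m)) *\<^sub>C (bracket (f i) ^^ m) (f j)"
      by (rule adj.sl2_string(2)[OF f_sl2])
        (use assms in \<open>simp_all add: bracket_e_f bracket_h_f pairing Am\<close>)
    then show ?thesis using True by simp
  next
    case False
    have comm: "bracket (e k) ((bracket (f i) ^^ n) y) = (bracket (f i) ^^ n) (bracket (e k) y)" for n y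
      using False by (induction n) (simp_all add: adj.act_commute[of "e k" "f i"] bracket_e_f)
    show ?thesis
    proof (cases "k = j")
      case True
      have "bracket (e k) ?\<theta> = (bracket (f i) ^^ m) (bracket (f i) (\<iota> (coroot j)))"
        unfolding comm using True by (simp add: bracket_e_f funpow_swap1)
      also have "bracket (f i) (\<iota> (coroot j)) = of_int (A $ j $ i) *\<^sub>C f i"
        by (simp add: bracket_anti[of "f i"] bracket_h_f pairing)
      also have "(bracket (f i) ^^ m) (of_int (A $ j $ i) *\<^sub>C f i) = 0"
      proof (cases m)
        \<comment> \<open>No further bracket with \<open>f i\<close> is left here, so the scalar
          itself has to vanish; this is where \<open>zero_sym\<close> enters.\<close>
        case 0
        then have "A $ j $ i = 0" using Am zero_sym by simp
        then show ?thesis by simp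
      next
        case (Suc n)
        then show ?thesis by (simp add: funpow_swap1 bracket_self del: funpow.simps)
            (simp add: funpow_swap1 bracket_self)
      qed
      finally show ?thesis .
    next
      case False
      then show ?thesis unfolding comm by (simp add: bracket_e_f)
    qed
  qed
  then have "bracket (e k) (word bracket f (replicate (Suc m) i) (f j)) = 0" for k
    by (simp only: word_replicate)
  then have "word bracket f (replicate (Suc m) i) (f j) = 0" by (rule maximal_f_word_zero)
  then show ?thesis by (metis word_replicate)
qed

lemma bracket_f_h: "bracket (f i) (\<iota> h) = \<alpha> i h *\<^sub>C f i"
  by (simp add: bracket_anti[of "f i"] bracket_h_f)

text \<open>The locally nilpotent elements form a subalgebra, brackets being covered by the Leibniz
  rule for the zero submodule. Among the generators only the \<open>f j\<close> with
  \<open>j\<close> different from \<open>i\<close> are not immediate; they need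
  \<open>serre\<close>.\<close>

lemma f_nilpotent: "\<exists>n. (bracket (f i) ^^ n) z = 0"
proof (rule lie_generated_induct[where P = "\<lambda>z. \<exists>n. (bracket (f i) ^^ n) z = 0", OF in_generated])
  let ?F = "bracket (f i)"
  have 0: "(?F ^^ (m + n)) x = 0" if "(?F ^^ n) x = 0" for m n x
    using that by (simp add: funpow_add)
  have "submodule bracket {0 :: 'g}"
    by (auto simp: submodule_def)
  note br = adj.funpow_act_in_submodule[OF this]
  have "\<exists>n. (?F ^^ n) (x + y) = 0" if "(?F ^^ m) x = 0" "(?F ^^ n) y = 0" for x y m n
    using 0[OF that(1), of n] 0[OF that(2), of m] by (intro exI[of _ "m + n"]) (simp add: add.commute)
  moreover have "\<exists>n. (?F ^^ n) (c *\<^sub>C x) = 0" if "(?F ^^ m) x = 0" for c x m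
    using that by auto
  moreover have "\<exists>n. (?F ^^ n) (bracket x y) = 0" if "(?F ^^ m) x = 0" "(?F ^^ n) y = 0" for x y m n
    using br[OF that(1), of n y] that(2) by auto
  moreover have "\<exists>n. (?F ^^ n) 0 = 0" by simp
  ultimately show "lie_subalgebra {z. \<exists>n. (?F ^^ n) z = 0}"
    unfolding lie_subalgebra_def complex_vector.subspace_def by blast
  fix x assume "x \<in> range \<iota> \<union> range e \<union> range f"
  then consider h where "x = \<iota> h" | j where "x = e j" | j where "x = f j" by blast
  then show "\<exists>n. (?F ^^ n) x = 0"
  proof cases
    case 1
    then show ?thesis by (intro exI[of _ 2]) (simp add: bracket_f_h bracket_self numeral_2_eq_2)
  next
    case (2 j)
    have "?F (e j) = (if i = j then - \<iota> (coroot j) else 0)"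
      by (simp add: bracket_anti[of "f i"] bracket_e_f)
    then show ?thesis using 2
      by (intro exI[of _ 3]) (simp add: bracket_f_h bracket_self numeral_3_eq_3)
  next
    case (3 j)
    show ?thesis
    proof (cases "i = j")
      case True
      then show ?thesis using 3 by (intro exI[of _ 1]) (simp add: bracket_self)
    qed (use 3 serre in auto)
  qed
qed

lemma e_nilpotent: "\<exists>n. (bracket (e i) ^^ n) z = 0"
proof -
  interpret sw: kac_moody_algebra A coroot \<alpha> "\<lambda>h. - \<iota> h" f e by (rule swap_kac_moody)
  show ?thesis by (rule sw.f_nilpotent)
qed

text \<open>
  In the product of the algebra with itself, the span of the pairs of mirrored words is the graph of the
  Chevalley involution: the elements it relates to \<open>0\<close> form an ideal that avoids the Cartan subalgebra.
\<close>

lemma e_word_zero: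
  assumes "word bracket f is (f k) = 0"
  shows "word bracket e is (e k) = 0"
proof -
  let ?\<iota> = "\<lambda>h. (\<iota> h, - \<iota> h)" and ?e = "\<lambda>i. (e i, f i)" and ?f = "\<lambda>i. (f i, e i)"
  interpret g: chevalley coroot \<alpha> ?\<iota> ?e ?f
    by (rule chevalley.intro)
      (auto simp: clinear_iff \<iota>_simps scaleC_prod_def bracket_prod_def bracket_h_e bracket_h_f bracket_e_f
        cartan_abelian bracket_anti[of "f _" "e _"] prod_eq_iff)
  let ?S = "range ?\<iota> \<union> range ?e \<union> range ?f"
  let ?K = "{x. (x, 0) \<in> complex_vector.span g.tri}"
  \<comment> \<open>Every \<open>z\<close> must be lifted to a pair in the generated subalgebra,
    because only that subalgebra is known to preserve the span of \<open>g.tri\<close>.\<close>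
  have proj: "\<exists>y. (x, y) \<in> lie_generated ?S" for x
  proof (rule lie_generated_induct[where P = "\<lambda>x. \<exists>y. (x, y) \<in> lie_generated ?S", OF in_generated])
    have "lie_subalgebra (lie_generated ?S)" by (rule lie_subalgebra_generated)
    then have L: "0 \<in> lie_generated ?S"
      "\<And>x y. x \<in> lie_generated ?S \<Longrightarrow> y \<in> lie_generated ?S \<Longrightarrow> x + y \<in> lie_generated ?S"
      "\<And>c x. x \<in> lie_generated ?S \<Longrightarrow> c *\<^sub>C x \<in> lie_generated ?S"
      "\<And>x y. x \<in> lie_generated ?S \<Longrightarrow> y \<in> lie_generated ?S \<Longrightarrow> bracket x y \<in> lie_generated ?S"
      unfolding lie_subalgebra_def complex_vector.subspace_def by blast+
    have "\<exists>y. (0, y) \<in> lie_generated ?S"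
      using L(1) unfolding zero_prod_def by blast
    moreover have "\<exists>y. (x + x', y) \<in> lie_generated ?S"
      if "(x, y) \<in> lie_generated ?S" "(x', y') \<in> lie_generated ?S" for x x' y y'
      using L(2)[OF that] by auto
    moreover have "\<exists>y. (c *\<^sub>C x, y) \<in> lie_generated ?S" if "(x, y) \<in> lie_generated ?S" for c x y
      using L(3)[OF that, of c] by (auto simp: scaleC_prod_def)
    moreover have "\<exists>y. (bracket x x', y) \<in> lie_generated ?S"
      if "(x, y) \<in> lie_generated ?S" "(x', y') \<in> lie_generated ?S" for x x' y y'
      using L(4)[OF that] by (auto simp: bracket_prod_def)
    ultimately show "lie_subalgebra {x. \<exists>y. (x, y) \<in> lie_generated ?S}"
      unfolding lie_subalgebra_def complex_vector.subspace_def by blast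
    show "\<exists>y. (x, y) \<in> lie_generated ?S" if "x \<in> range \<iota> \<union> range e \<union> range f" for x
      using that lie_generated_base[of _ ?S] by fast
  qed
  have "lie_ideal ?K"
    unfolding lie_ideal_def complex_vector.subspace_def
  proof (intro conjI allI ballI; clarsimp)
    show "(0, 0) \<in> complex_vector.span g.tri"
      using complex_vector.span_zero[of g.tri] by (simp add: zero_prod_def)
    show "(x + y, 0) \<in> complex_vector.span g.tri"
      if "(x, 0) \<in> complex_vector.span g.tri" "(y, 0) \<in> complex_vector.span g.tri" for x y
      using complex_vector.span_add[OF that] by simp
    show "(c *\<^sub>C x, 0) \<in> complex_vector.span g.tri" if "(x, 0) \<in> complex_vector.span g.tri" for c x
      using complex_vector.span_scale[OF that, of c] by (simp add: scaleC_prod_def)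
    show "(bracket z x, 0) \<in> complex_vector.span g.tri" if "(x, 0) \<in> complex_vector.span g.tri" for z x
    proof -
      obtain y where "(z, y) \<in> lie_generated ?S" using proj by blast
      from g.tri_generated[OF this that] show ?thesis by (simp add: bracket_prod_def)
    qed
  qed
  moreover have "\<iota> h = 0" if h: "(\<iota> h, 0) \<in> complex_vector.span g.tri" for h
  proof -
    \<comment> \<open>These words have nonzero weight. Once an element of
      \<open>range ?\<iota>\<close> is split off, the remainder \<open>w\<close> has weight zero and
      so vanishes; comparing components then gives \<open>\<iota> h = 0\<close>.\<close>
    let ?W = "{word bracket ?e is (?e k) | is k. True} \<union> {word bracket ?f is (?f k) | is k. True}"
    have "0 = ?\<iota> 0" "?\<iota> a + ?\<iota> b = ?\<iota> (a + b)" "c *\<^sub>C ?\<iota> a = ?\<iota> (c *\<^sub>C a)" for a b c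
      by (simp_all add: \<iota>_simps zero_prod_def scaleC_prod_def)
    then have "complex_vector.subspace (range ?\<iota>)"
      unfolding complex_vector.subspace_def by blast
    then have range: "complex_vector.span (range ?\<iota>) = range ?\<iota>"
      by (simp only: complex_vector.span_eq_iff)
    have "(\<iota> h, 0) \<in> complex_vector.span (range ?\<iota> \<union> ?W)"
      using h by (simp only: g.tri_def Un_assoc)
    then obtain h' w where w: "w \<in> complex_vector.span ?W" "(\<iota> h, 0) = ?\<iota> h' + w"
      unfolding complex_vector.span_Un range by blast
    have "\<iota> h = \<iota> (h - h') + \<iota> h'" using \<iota>_simps(1)[of "h - h'" h'] by simp
    with w(2) have w': "w = (\<iota> (h - h'), \<iota> h')" by (cases w) auto
    have "w = 0"
    proof (rule ccontr)
      assume "w \<noteq> 0"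
      have "w \<in> weight_space ?\<iota> bracket 0"
        by (simp add: w' weight_space_def bracket_prod_def cartan_abelian zero_prod_def)
      then have "\<exists>y\<in>?W. y \<noteq> 0 \<and> y \<in> weight_space ?\<iota> bracket 0"
        using g.e_word_weight g.f_word_weight w(1) \<open>w \<noteq> 0\<close>
        by (intro adj.weight_vector_in_span) blast+
      then obtain y js k where y: "y \<noteq> 0" "y \<in> weight_space ?\<iota> bracket 0"
        "y = word bracket ?e js (?e k) \<or> y = word bracket ?f js (?f k)" by blast
      define s where "s = sum_list (map \<alpha> (js @ [k]))"
      have "y \<in> weight_space ?\<iota> bracket s \<or> y \<in> weight_space ?\<iota> bracket (- s)"
        using g.e_word_weight g.f_word_weight y(3) unfolding s_def by blast
      then have "0 = s \<or> 0 = - s" using adj.weight_space_unique[OF y(2) _ y(1)] by blast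
      then have "s = 0" by simp
      moreover have "s \<noteq> 0" unfolding s_def by (rule sum_list_roots_nonzero) simp
      ultimately show False by contradiction
    qed
    with w(2) show ?thesis by auto
  qed
  then have "?K \<inter> range \<iota> = {0}"
    using \<iota>_simps(4) complex_vector.span_zero[of g.tri] by (auto simp: zero_prod_def)
  ultimately have "?K = {0}" by (rule no_ideal)
  moreover have "(word bracket e is (e k), word bracket f is (f k)) \<in> g.tri"
    unfolding g.tri_def by (auto simp flip: word_prod)
  ultimately show ?thesis using assms complex_vector.span_base by auto
qed

lemma f_word_zero: "word bracket e is (e k) = 0 \<Longrightarrow> word bracket f is (f k) = 0"
proof -
  interpret sw: kac_moody_algebra A coroot \<alpha> "\<lambda>h. - \<iota> h" f e by (rule swap_kac_moody)
  show "word bracket e is (e k) = 0 \<Longrightarrow> word bracket f is (f k) = 0" by (rule sw.e_word_zero)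
qed

lemma root_dual_closed: "sum_list (map \<alpha> is) \<in> dual"
  unfolding sum_list_eq_rt by (rule rt_dual)

text \<open>A word in the \<open>e\<close> and its mirror in the \<open>f\<close> vanish together
  and have opposite weights.\<close>

lemma roots_symmetric:
  assumes "\<beta> \<in> wt \<iota> bracket"
  shows "- \<beta> \<in> wt \<iota> bracket"
proof -
  obtain x where x: "x \<in> weight_space \<iota> bracket \<beta>" "x \<noteq> 0" "\<beta> \<in> dual"
    using assms by (rule adj.wtE)
  from x(1,2) show ?thesis
  proof (cases rule: root_space_cases)
    case zero
    then show ?thesis using assms by simp
  next
    case (pos js k)
    then have "word bracket f js (f k) \<noteq> 0" using e_word_zero by blast
    then show ?thesis using adj.wtI[OF f_word_weight, of js k] pos(1) x(3) dual_closed by metis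
  next
    case (neg js k)
    then have "word bracket e js (e k) \<noteq> 0" using f_word_zero by blast
    then show ?thesis using adj.wtI[OF e_word_weight, of js k] neg(1) x(3) dual_closed
      by (metis add.inverse_inverse)
  qed
qed

end

lemma nat_combs_zero: "0 \<in> nat_combs S"
  unfolding nat_combs_eq by (auto intro: exI[of _ "[]"])

lemma nat_combs_add: "x \<in> nat_combs S \<Longrightarrow> y \<in> nat_combs S \<Longrightarrow> x + y \<in> nat_combs S"
  unfolding nat_combs_eq by clarify (metis set_append sum_list_append Un_least)

lemma nat_combs_base: "x \<in> S \<Longrightarrow> x \<in> nat_combs S"
  unfolding nat_combs_eq by (auto intro!: exI[of _ "[x]"])

lemma nat_combs_subset:
  assumes "S \<subseteq> nat_combs T" shows "nat_combs S \<subseteq> nat_combs T"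
proof -
  have "set bs \<subseteq> S \<Longrightarrow> sum_list bs \<in> nat_combs T" for bs
    using assms by (induction bs) (auto intro: nat_combs_zero nat_combs_add)
  then show ?thesis unfolding nat_combs_eq[of S] by blast
qed

section \<open>Roots of height one\<close>

text \<open>
  The simple root vectors for \<open>J\<close> move roots of height \<open>1\<close> to roots of height \<open>1\<close>, so that the span
  of this set is stable under all simple root vectors as soon as \<open>B\<close> is stable under those for \<open>J\<close>. This
  replaces the Poincare--Birkhoff--Witt theorem.
\<close>

inductive_set ht1_closure
  for \<iota> :: "'h::complex_vector \<Rightarrow> 'g::complex_lie_algebra"
    and \<alpha> :: "'i::finite \<Rightarrow> 'h \<Rightarrow> complex"
    and act :: "'g \<Rightarrow> 'v::complex_vector \<Rightarrow> 'v" and J B where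
  base: "b \<in> B \<Longrightarrow> b \<in> ht1_closure \<iota> \<alpha> act J B"
| step: "z \<in> weight_space \<iota> bracket \<beta> \<Longrightarrow> \<beta> \<in> roots_ht1 \<iota> \<alpha> (- J) \<Longrightarrow> y \<in> ht1_closure \<iota> \<alpha> act J B
    \<Longrightarrow> act z y \<in> ht1_closure \<iota> \<alpha> act J B"

context kac_moody_algebra
begin

lemma \<alpha>_rt: "\<alpha> k = rt \<alpha> (\<lambda>i. if i = k then 1 else 0)"
  by (simp add: rt_single scaleC_one)

lemma e_nonzero: "e k \<noteq> 0"
proof
  assume "e k = 0"
  then have "\<iota> (coroot k) = \<iota> 0" using bracket_e_f[of k k] \<iota>_simps(4) by simp
  then have "0 \<in> range coroot" using cartan_inj by (metis injD rangeI)
  then show False using coroots_indep(2) complex_vector.dependent_zero by blast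
qed

lemma \<alpha>_root: "\<alpha> k \<in> wt \<iota> bracket"
  using adj.wtI[OF e_weight e_nonzero root_dual] .

lemma roots_ht1_iff:
  "rt \<alpha> n \<in> roots_ht1 \<iota> \<alpha> K \<longleftrightarrow> rt \<alpha> n \<in> wt \<iota> bracket \<and> (\<Sum>i\<in>K. n i) = 1"
  using of_int_eq_1_iff[of "\<Sum>i\<in>K. n i", where ?'a = complex]
  by (auto simp: roots_ht1_def roots_def ht_rt rt_eq_0 simp del: of_int_sum)

text \<open>The coordinates of a root share one sign, and a sum equal to 1 rules out the nonpositive
  case.\<close>

lemma roots_ht1_cases:
  assumes "\<beta> \<in> roots_ht1 \<iota> \<alpha> K"
  obtains n where "\<beta> = rt \<alpha> n" "\<And>i. n i \<ge> 0" "\<beta> \<in> wt \<iota> bracket" "(\<Sum>i\<in>K. n i) = 1"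
proof -
  have wt: "\<beta> \<in> wt \<iota> bracket" using assms by (auto simp: roots_ht1_def roots_def split: if_splits)
  then obtain n where n: "\<beta> = rt \<alpha> n" "(\<forall>i. n i \<ge> 0) \<or> (\<forall>i. n i \<le> 0)"
    by (rule roots_in_lattice)
  have 1: "(\<Sum>i\<in>K. n i) = 1" using assms n(1) roots_ht1_iff by simp
  have "\<not> (\<forall>i. n i \<le> 0)" using sum_nonpos[of K n] 1 by force
  with n wt 1 that show thesis by blast
qed

lemma simple_roots_ht1: "k \<in> K \<Longrightarrow> \<alpha> k \<in> roots_ht1 \<iota> \<alpha> K"
  using \<alpha>_root[of k] roots_ht1_iff[of "\<lambda>i. if i = k then 1 else 0" K] by (simp flip: \<alpha>_rt)

lemma roots_ht1_add:
  assumes "\<beta> \<in> roots_ht1 \<iota> \<alpha> (- J)" "set is \<subseteq> J" "sum_list (map \<alpha> is) + \<beta> \<in> wt \<iota> bracket"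
  shows "sum_list (map \<alpha> is) + \<beta> \<in> roots_ht1 \<iota> \<alpha> (- J)"
proof -
  obtain n where n: "\<beta> = rt \<alpha> n" "(\<Sum>i\<in>- J. n i) = 1"
    using assms(1) by (rule roots_ht1_cases)
  have eq: "sum_list (map \<alpha> is) + \<beta> = rt \<alpha> (\<lambda>i. int (count_list is i) + n i)"
    unfolding rt_add sum_list_eq_rt n(1) ..
  have "(\<Sum>i\<in>- J. int (count_list is i) + n i) = (\<Sum>i\<in>- J. n i)"
    using assms(2) by (intro sum.cong) (auto simp: count_list_0_iff)
  then show ?thesis using assms(3) n(2) unfolding eq roots_ht1_iff by simp
qed

lemma roots_ht1_act:
  assumes "z \<in> weight_space \<iota> bracket \<beta>" "\<beta> \<in> roots_ht1 \<iota> \<alpha> (- J)"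
    and "x \<in> weight_space \<iota> bracket (sum_list (map \<alpha> is))" "set is \<subseteq> J"
  shows "bracket x z \<noteq> 0 \<Longrightarrow> sum_list (map \<alpha> is) + \<beta> \<in> roots_ht1 \<iota> \<alpha> (- J)"
    and "bracket x z \<in> weight_space \<iota> bracket (sum_list (map \<alpha> is) + \<beta>)"
proof -
  show w: "bracket x z \<in> weight_space \<iota> bracket (sum_list (map \<alpha> is) + \<beta>)"
    by (rule adj.act_weight_space) fact+
  obtain n where "\<beta> = rt \<alpha> n" using assms(2) by (rule roots_ht1_cases)
  then have "sum_list (map \<alpha> is) + \<beta> \<in> dual"
    by (simp only: dual_closed root_dual_closed rt_dual)
  then show "sum_list (map \<alpha> is) + \<beta> \<in> roots_ht1 \<iota> \<alpha> (- J)" if "bracket x z \<noteq> 0"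
    using roots_ht1_add[OF assms(2,4)] adj.wtI[OF w that] by blast
qed

text \<open>For \<open>k\<close> outside \<open>J\<close>, \<open>e k\<close> is itself a root
  vector of height 1 and gives one more step. For \<open>k\<close> in \<open>J\<close> it is
  commuted past each \<open>z\<close>: the commutator is zero or again of height 1, and finally
  \<open>e k\<close> acts on \<open>B\<close>.\<close>

lemma ht1_closure_act:
  assumes "lie_rep act" and B: "\<And>j b. j \<in> J \<Longrightarrow> b \<in> B \<Longrightarrow> act (e j) b \<in> B"
    and x: "x \<in> complex_vector.span (ht1_closure \<iota> \<alpha> act J B)"
  shows "act (e k) x \<in> complex_vector.span (ht1_closure \<iota> \<alpha> act J B)"
proof -
  interpret lie_rep act by fact
  let ?X = "ht1_closure \<iota> \<alpha> act J B"
  have sp: "act z y \<in> complex_vector.span ?X"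
    if "z \<in> weight_space \<iota> bracket \<beta>" "\<beta> \<in> roots_ht1 \<iota> \<alpha> (- J)" "y \<in> complex_vector.span ?X" for z \<beta> y
    using act_span[of ?X z ?X y] ht1_closure.step[OF that(1,2)] complex_vector.span_base that(3) by blast
  show ?thesis
  proof (rule act_span[OF _ x])
    fix v assume "v \<in> ?X"
    then show "act (e k) v \<in> complex_vector.span ?X"
    proof (cases "k \<in> J")
      case False
      then show ?thesis using sp[OF e_weight simple_roots_ht1] complex_vector.span_base[of _ ?X] \<open>v \<in> ?X\<close> by simp
    next
      case True
      from \<open>v \<in> ?X\<close> show ?thesis
      proof induction
        case (base b)
        then show ?case using B[OF True] ht1_closure.base complex_vector.span_base by metis
      next
        case (step z \<beta> y)
        have ek: "e k \<in> weight_space \<iota> bracket (sum_list (map \<alpha> [k]))" "set [k] \<subseteq> J"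
          using e_weight True by simp_all
        note r = roots_ht1_act[OF step.hyps(1,2) ek]
        have "act (bracket (e k) z) y \<in> complex_vector.span ?X"
        proof (cases "bracket (e k) z = 0")
          case False
          then show ?thesis using sp[OF r(2)] r(1) complex_vector.span_base[OF step.hyps(3)] by blast
        qed (simp add: complex_vector.span_zero)
        moreover have "act z (act (e k) y) \<in> complex_vector.span ?X"
          by (rule sp) (rule step)+
        ultimately show ?case by (simp add: act_commute[of "e k" z] complex_vector.span_add)
      qed
    qed
  qed
qed

section \<open>Positive roots as sums of roots of height one\<close>

lemma e_word_closed:
  assumes "\<And>k x. x \<in> S \<Longrightarrow> act (e k) x \<in> S" "x \<in> S"
  shows "word act e is x \<in> S"
  using assms by (induction "is") auto

lemma positive_root_in_nat_combs_ht1: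
  assumes "\<beta> \<in> pos_roots \<iota> \<alpha> - pos_roots_of \<iota> \<alpha> J"
  shows "\<beta> \<in> nat_combs (roots_ht1 \<iota> \<alpha> (- J))"
proof -
  let ?D = "roots_ht1 \<iota> \<alpha> (- J)"
  \<comment> \<open>Every letter \<open>e k\<close> that starts a word must belong to
    \<open>?B\<close>: the first set takes the indices in \<open>J\<close>, the second the
    others.\<close>
  let ?B = "{b. \<exists>is. set is \<subseteq> J \<and> b \<in> weight_space \<iota> bracket (sum_list (map \<alpha> is))}
    \<union> {b. \<exists>\<gamma>\<in>?D. b \<in> weight_space \<iota> bracket \<gamma>}"
  let ?X = "ht1_closure \<iota> \<alpha> bracket J ?B"
  from assms have \<beta>: "\<beta> \<in> wt \<iota> bracket" "\<beta> \<noteq> 0" "\<beta> \<in> nat_combs (range \<alpha>)" "\<beta> \<notin> int_combs (\<alpha> ` J)"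
    by (auto simp: pos_roots_def pos_roots_of_def roots_def)
  obtain js k where w: "\<beta> = sum_list (map \<alpha> (js @ [k]))" "word bracket e js (e k) \<noteq> 0"
  proof -
    note th = that
    obtain x where x: "x \<in> weight_space \<iota> bracket \<beta>" "x \<noteq> 0" using \<beta>(1) by (rule adj.wtE)
    then show thesis
    proof (cases rule: root_space_cases)
      case zero
      with \<beta>(2) show ?thesis by simp
    next
      case (pos js k)
      then show ?thesis by (rule th)
    next
      case (neg js k)
      obtain ks where "\<beta> = sum_list (map \<alpha> ks)" using \<beta>(3) unfolding nat_combs_image by blast
      with neg(1) have "sum_list (map \<alpha> (ks @ js @ [k])) = 0" by simp
      moreover have "sum_list (map \<alpha> (ks @ js @ [k])) \<noteq> 0" by (rule sum_list_roots_nonzero) simp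
      ultimately show ?thesis by contradiction
    qed
  qed
  have zero: "0 \<in> weight_space \<iota> bracket \<mu>" for \<mu>
    by (rule complex_vector.subspace_0) (rule adj.weight_space_subspace)
  have Bclosed: "bracket (e j) b \<in> ?B" if j: "j \<in> J" and b: "b \<in> ?B" for j b
    using b
  proof
    assume "b \<in> {b. \<exists>is. set is \<subseteq> J \<and> b \<in> weight_space \<iota> bracket (sum_list (map \<alpha> is))}"
    then obtain ks where "set ks \<subseteq> J" "b \<in> weight_space \<iota> bracket (sum_list (map \<alpha> ks))" by blast
    then have "bracket (e j) b \<in> weight_space \<iota> bracket (sum_list (map \<alpha> (j # ks)))" "set (j # ks) \<subseteq> J"
      using adj.act_weight_space[OF e_weight] j by simp_all
    then show ?thesis by blast
  next
    assume "b \<in> {b. \<exists>\<gamma>\<in>?D. b \<in> weight_space \<iota> bracket \<gamma>}"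
    then obtain \<gamma> where \<gamma>: "b \<in> weight_space \<iota> bracket \<gamma>" "\<gamma> \<in> ?D" by blast
    have ej: "e j \<in> weight_space \<iota> bracket (sum_list (map \<alpha> [j]))" "set [j] \<subseteq> J"
      using e_weight j by simp_all
    show ?thesis
    proof (cases "bracket (e j) b = 0")
      case True
      \<comment> \<open>A zero bracket is filed under the empty word, since the zero vector lies in
        every weight space.\<close>
      have "bracket (e j) b \<in> weight_space \<iota> bracket (sum_list (map \<alpha> []))" "set [] \<subseteq> J"
        using True zero by simp_all
      then show ?thesis by blast
    next
      case False
      then show ?thesis using roots_ht1_act[OF \<gamma> ej] by blast
    qed
  qed
  have "e k \<in> ?B"
  proof (cases "k \<in> J")
    case True
    then have "set [k] \<subseteq> J" "e k \<in> weight_space \<iota> bracket (sum_list (map \<alpha> [k]))"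
      using e_weight by simp_all
    then show ?thesis by blast
  next
    case False
    then show ?thesis using e_weight simple_roots_ht1[of k "- J"] by blast
  qed
  then have "e k \<in> complex_vector.span ?X"
    by (intro complex_vector.span_base ht1_closure.base)
  then have sp: "word bracket e js (e k) \<in> complex_vector.span ?X"
    using ht1_closure_act[OF adj.lie_rep_axioms Bclosed] by (rule e_word_closed[rotated])
  \<comment> \<open>A nonzero step always leads to the second form: from the first one by
    \<open>roots_ht1_act\<close> for the reversed bracket, from the second one by adding
    \<beta>.\<close>
  have wt: "(\<exists>is. set is \<subseteq> J \<and> y \<in> weight_space \<iota> bracket (sum_list (map \<alpha> is)))
      \<or> (\<exists>\<gamma>\<in>nat_combs ?D. y \<in> weight_space \<iota> bracket \<gamma>)" if "y \<in> ?X" for y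
    using that
  proof induction
    case (base b)
    then show ?case using nat_combs_base by blast
  next
    case (step z \<beta> y)
    from step.IH show ?case
    proof
      assume "\<exists>is. set is \<subseteq> J \<and> y \<in> weight_space \<iota> bracket (sum_list (map \<alpha> is))"
      then obtain ks where ks: "y \<in> weight_space \<iota> bracket (sum_list (map \<alpha> ks))" "set ks \<subseteq> J" by blast
      note r = roots_ht1_act[OF step.hyps(1,2) ks]
      show ?case
      proof (cases "bracket y z = 0")
        case True
        have "bracket z y \<in> weight_space \<iota> bracket (sum_list (map \<alpha> []))" "set [] \<subseteq> J"
          using True zero by (simp_all add: bracket_anti[of z y])
        then show ?thesis by blast
      next
        case False
        have "bracket z y \<in> weight_space \<iota> bracket (sum_list (map \<alpha> ks) + \<beta>)"
          using complex_vector.subspace_neg[OF adj.weight_space_subspace r(2)]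
          by (simp add: bracket_anti[of z y])
        then show ?thesis using nat_combs_base[OF r(1)[OF False]] by blast
      qed
    next
      assume "\<exists>\<gamma>\<in>nat_combs ?D. y \<in> weight_space \<iota> bracket \<gamma>"
      then show ?case
        using adj.act_weight_space[OF step.hyps(1)] nat_combs_add[OF nat_combs_base[OF step.hyps(2)]]
        by blast
    qed
  qed
  have ex: "\<exists>\<nu>. y \<in> weight_space \<iota> bracket \<nu>" if "y \<in> ?X" for y
    using wt[OF that] by blast
  have "word bracket e js (e k) \<in> weight_space \<iota> bracket \<beta>"
    unfolding w(1) by (rule e_word_weight)
  from adj.weight_vector_in_span[OF ex sp this w(2)]
  obtain y where y: "y \<in> ?X" "y \<noteq> 0" "y \<in> weight_space \<iota> bracket \<beta>" by blast
  from wt[OF y(1)] show ?thesis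
  proof
    assume "\<exists>is. set is \<subseteq> J \<and> y \<in> weight_space \<iota> bracket (sum_list (map \<alpha> is))"
    then obtain ks where ks: "set ks \<subseteq> J" "y \<in> weight_space \<iota> bracket (sum_list (map \<alpha> ks))" by blast
    then have "\<beta> = sum_list (map \<alpha> ks)" using adj.weight_space_unique y by blast
    then have "\<beta> = rt \<alpha> (\<lambda>i. int (count_list ks i))" by (simp only: sum_list_eq_rt)
    then have "\<beta> \<in> int_combs (\<alpha> ` J)" using ks(1) by (auto simp: rt_int_combs count_list_0_iff)
    then show ?thesis using \<beta>(4) by contradiction
  next
    assume "\<exists>\<gamma>\<in>nat_combs ?D. y \<in> weight_space \<iota> bracket \<gamma>"
    then show ?thesis using adj.weight_space_unique y by blast
  qed
qed

lemma roots_ht1_positive: "roots_ht1 \<iota> \<alpha> (- J) \<subseteq> pos_roots \<iota> \<alpha> - pos_roots_of \<iota> \<alpha> J"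
proof
  fix \<beta> assume "\<beta> \<in> roots_ht1 \<iota> \<alpha> (- J)"
  then obtain n where n: "\<beta> = rt \<alpha> n" "\<And>i. n i \<ge> 0" "\<beta> \<in> wt \<iota> bracket" "(\<Sum>i\<in>- J. n i) = 1"
    by (rule roots_ht1_cases) blast
  have "rt \<alpha> n = (\<Sum>x\<in>range \<alpha>. of_nat (nat (n (inv \<alpha> x))) *\<^sub>C x)"
    using roots_indep(1) n(2) by (subst sum.reindex) (simp_all add: rt_def)
  then have "\<beta> \<in> nat_combs (range \<alpha>)"
    unfolding nat_combs_def n(1)
    by (intro CollectI exI[of _ "range \<alpha>"] exI[of _ "\<lambda>x. nat (n (inv \<alpha> x))"]) simp
  moreover have "\<exists>i. i \<notin> J \<and> n i \<noteq> 0"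
  proof (rule ccontr)
    assume "\<not> ?thesis"
    then have "(\<Sum>i\<in>- J. n i) = 0" by (intro sum.neutral) auto
    with n(4) show False by simp
  qed
  then have "\<beta> \<notin> int_combs (\<alpha> ` J)" "\<beta> \<noteq> 0" by (auto simp: n(1) rt_int_combs rt_eq_0)
  ultimately show "\<beta> \<in> pos_roots \<iota> \<alpha> - pos_roots_of \<iota> \<alpha> J"
    using n(3) by (simp add: pos_roots_def pos_roots_of_def roots_def)
qed

lemma nat_combs_positive_roots:
  "nat_combs (pos_roots \<iota> \<alpha> - pos_roots_of \<iota> \<alpha> J) = nat_combs (roots_ht1 \<iota> \<alpha> (- J))"
proof (intro equalityI nat_combs_subset subsetI)
  show "\<beta> \<in> nat_combs (pos_roots \<iota> \<alpha> - pos_roots_of \<iota> \<alpha> J)" if "\<beta> \<in> roots_ht1 \<iota> \<alpha> (- J)" for \<beta>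
    using that roots_ht1_positive nat_combs_base by blast
qed (rule positive_root_in_nat_combs_ht1)

text \<open>By \<open>roots_symmetric\<close> the mirrored algebra has the same roots, so a closure
  built from lowering operators refers to the same set of roots of height 1.\<close>

lemma roots_ht1_uminus: "roots_ht1 (\<lambda>h. - \<iota> h) \<alpha> K = roots_ht1 \<iota> \<alpha> K"
proof -
  have "wt (\<lambda>h. - \<iota> h) bracket = wt \<iota> (bracket :: 'g \<Rightarrow> _)"
  proof (intro set_eqI)
    fix \<mu>
    have "\<mu> \<in> wt (\<lambda>h. - \<iota> h) bracket \<longleftrightarrow> - \<mu> \<in> wt \<iota> bracket"
      using dual_closed(4)[of \<mu>] dual_closed(4)[of "- \<mu>"] by (auto simp: wt_def adj.weight_space_uminus)
    also have "\<dots> \<longleftrightarrow> \<mu> \<in> wt \<iota> bracket"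
      using roots_symmetric[of \<mu>] roots_symmetric[of "- \<mu>"] by auto
    finally show "\<mu> \<in> wt (\<lambda>h. - \<iota> h) bracket \<longleftrightarrow> \<mu> \<in> wt \<iota> bracket" .
  qed
  then show ?thesis by (simp add: roots_ht1_def roots_def)
qed

end

section \<open>String arguments for weights and roots\<close>

lemma diff_left_eq_iff: "a - b = a - c \<longleftrightarrow> b = (c :: 'a::ab_group_add)"
  by (metis add_diff_cancel_left' diff_add_cancel diff_diff_eq2)

context kac_moody_algebra
begin

text \<open>A weight vector is raised as far as possible, by \<open>s\<close> steps. The coroot then
  has eigenvalue \<open>m + 2 * s\<close>, so \<open>s + t\<close> lowering steps stay nonzero and
  end \<open>t\<close> steps below \<mu>.\<close>

lemma string_down:
  assumes "lie_rep act" and \<mu>: "\<mu> \<in> wt \<iota> act" "\<mu> (coroot j) = of_nat m" and t: "t \<le> m"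
    and nilp: "\<And>x. x \<in> weight_space \<iota> act \<mu> \<Longrightarrow> \<exists>n. (act (e j) ^^ n) x = 0"
  shows "\<mu> - of_nat t *\<^sub>C \<alpha> j \<in> wt \<iota> act"
proof -
  interpret lie_rep act by fact
  obtain x where x: "x \<in> weight_space \<iota> act \<mu>" "x \<noteq> 0" "\<mu> \<in> dual" using \<mu>(1) by (rule wtE)
  obtain s where s: "(act (e j) ^^ s) x \<noteq> 0" "(act (e j) ^^ Suc s) x = 0"
  proof -
    define n where "n = (LEAST n. (act (e j) ^^ n) x = 0)"
    have n: "(act (e j) ^^ n) x = 0" unfolding n_def by (rule LeastI_ex) (rule nilp[OF x(1)])
    then obtain s where "n = Suc s" using x(2) by (cases n) auto
    moreover have "(act (e j) ^^ s) x \<noteq> 0" using not_less_Least[of s "\<lambda>n. (act (e j) ^^ n) x = 0"] \<open>n = Suc s\<close>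
      unfolding n_def by simp
    ultimately show thesis using n that by blast
  qed
  let ?z = "(act (e j) ^^ s) x"
  have z: "?z \<in> weight_space \<iota> act (of_nat s *\<^sub>C \<alpha> j + \<mu>)"
    by (rule funpow_weight_space[OF e_weight x(1)])
  have "act (\<iota> (coroot j)) ?z = of_nat (m + 2 * s) *\<^sub>C ?z"
    using weight_spaceD[OF z] by (simp add: scaleC_fun_def scaleC_complex_def pairing diag \<mu>(2) algebra_simps)
  then have nz: "(act (f j) ^^ (s + t)) ?z \<noteq> 0"
    using t s by (intro sl2_string_nonzero[OF f_sl2]) (simp_all only: funpow.simps o_apply, auto simp flip: of_nat_mult of_nat_add)
  have "(act (f j) ^^ (s + t)) ?z \<in> weight_space \<iota> act (of_nat (s + t) *\<^sub>C (- \<alpha> j) + (of_nat s *\<^sub>C \<alpha> j + \<mu>))"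
    by (rule funpow_weight_space[OF f_weight z])
  also have "of_nat (s + t) *\<^sub>C (- \<alpha> j) + (of_nat s *\<^sub>C \<alpha> j + \<mu>) = \<mu> - of_nat t *\<^sub>C \<alpha> j"
    by (simp add: scaleC_fun_def scaleC_complex_def fun_eq_iff algebra_simps)
  finally show ?thesis
    by (rule wtI[OF _ nz]) (simp only: dual_closed x(3) root_dual)
qed

lemma scale_\<alpha>_rt: "of_nat p *\<^sub>C \<alpha> j = rt \<alpha> (\<lambda>i. if i = j then int p else 0)"
  by (simp add: rt_single)

lemma roots_ht1_diff:
  assumes "\<beta> \<in> roots_ht1 \<iota> \<alpha> (- J)" "j \<in> J" "\<beta> - of_nat p *\<^sub>C \<alpha> j \<in> wt \<iota> bracket"
  shows "\<beta> - of_nat p *\<^sub>C \<alpha> j \<in> roots_ht1 \<iota> \<alpha> (- J)"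
proof -
  obtain n where n: "\<beta> = rt \<alpha> n" "(\<Sum>i\<in>- J. n i) = 1"
    using assms(1) by (rule roots_ht1_cases)
  have eq: "\<beta> - of_nat p *\<^sub>C \<alpha> j = rt \<alpha> (\<lambda>i. n i - (if i = j then int p else 0))"
    unfolding rt_diff scale_\<alpha>_rt n(1) ..
  have "(\<Sum>i\<in>- J. n i - (if i = j then int p else 0)) = (\<Sum>i\<in>- J. n i)"
    using assms(2) by (intro sum.cong) auto
  then show ?thesis using assms(3) n(2) unfolding eq roots_ht1_iff by simp
qed

text \<open>The shift \<open>p\<close> is the pairing with the coroot if that is positive, otherwise
  1 or 0 according to whether \<open>\<beta> - \<alpha> j\<close> occurs in the adjoint
  representation. In \<open>weights_lower_bound\<close>, \<open>c \<le> int p\<close> ensures that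
  strings are long enough and \<open>p \<ge> 1\<close> that the height drops.\<close>

lemma root_step:
  assumes \<beta>: "\<beta> \<in> roots_ht1 \<iota> \<alpha> (- J)" and j: "j \<in> J"
  shows "\<exists>p. \<beta> - of_nat p *\<^sub>C \<alpha> j \<in> roots_ht1 \<iota> \<alpha> (- J) \<and> (\<exists>c. \<beta> (coroot j) = of_int c \<and> c \<le> int p)
    \<and> (\<beta> - \<alpha> j \<in> wt \<iota> bracket \<longrightarrow> p \<ge> 1)"
proof -
  obtain n where n: "\<beta> = rt \<alpha> n" and wt: "\<beta> \<in> wt \<iota> bracket"
    using \<beta> by (rule roots_ht1_cases)
  obtain c where c: "\<beta> (coroot j) = of_int c" unfolding n rt_coroot by blast
  show ?thesis
  proof (cases "c \<ge> 1")
    case True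
    have "\<beta> - of_nat (nat c) *\<^sub>C \<alpha> j \<in> wt \<iota> bracket"
      by (rule string_down[OF adj.lie_rep_axioms wt _ order_refl e_nilpotent]) (use c True in simp)
    from roots_ht1_diff[OF \<beta> j this] show ?thesis
      using c True by (intro exI[of _ "nat c"]) (simp, linarith)
  next
    case False
    show ?thesis
    proof (cases "\<beta> - \<alpha> j \<in> wt \<iota> bracket")
      case True
      then show ?thesis using roots_ht1_diff[OF \<beta> j, of 1] c False
        by (intro exI[of _ 1]) (simp add: scaleC_one)
    qed (use \<beta> c False in \<open>auto intro!: exI[of _ 0]\<close>)
  qed
qed

text \<open>The Jacobi identity splits off the first letter \<open>i\<close>. Either the rest of the
  word already acts nontrivially on \<open>x\<close>, and this bracket lacks just
  \<open>\<alpha> i\<close>, or the letter is absorbed into \<open>x\<close> and induction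
  applies.\<close>

lemma bracket_word_nonzero:
  assumes "x \<in> weight_space \<iota> bracket \<gamma>" "bracket (word bracket e ks (e k)) x \<noteq> 0"
  shows "\<exists>j\<in>set (ks @ [k]). \<exists>z. z \<noteq> 0 \<and> z \<in> weight_space \<iota> bracket (\<gamma> + sum_list (map \<alpha> (ks @ [k])) - \<alpha> j)"
  using assms
proof (induction ks arbitrary: x \<gamma>)
  case Nil
  then have "x \<noteq> 0" by auto
  then show ?case using Nil.prems(1) by auto
next
  case (Cons i ks)
  let ?y = "word bracket e ks (e k)"
  have "bracket (word bracket e (i # ks) (e k)) x = bracket (e i) (bracket ?y x) - bracket ?y (bracket (e i) x)"
    by (simp add: adj.act_bracket)
  with Cons.prems(2) consider "bracket ?y x \<noteq> 0" | "bracket ?y (bracket (e i) x) \<noteq> 0" by fastforce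
  then show ?case
  proof cases
    case 1
    have "bracket ?y x \<in> weight_space \<iota> bracket (sum_list (map \<alpha> (ks @ [k])) + \<gamma>)"
      by (rule adj.act_weight_space[OF e_word_weight Cons.prems(1)])
    also have "sum_list (map \<alpha> (ks @ [k])) + \<gamma> = \<gamma> + sum_list (map \<alpha> ((i # ks) @ [k])) - \<alpha> i"
      by simp
    finally show ?thesis using 1 by (intro bexI[of _ i] exI[of _ "bracket ?y x"]) simp_all
  next
    case 2
    have "\<alpha> i + \<gamma> + sum_list (map \<alpha> (ks @ [k])) = \<gamma> + sum_list (map \<alpha> ((i # ks) @ [k]))"
      by simp
    moreover have "set (ks @ [k]) \<subseteq> set ((i # ks) @ [k])" by auto
    ultimately show ?thesis
      using Cons.IH[OF adj.act_weight_space[OF e_weight Cons.prems(1)] 2] by (metis subsetD)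
  qed
qed

lemma sum_count_list: "finite K \<Longrightarrow> (\<Sum>i\<in>K. int (count_list is i)) = int (length (filter (\<lambda>i. i \<in> K) is))"
proof (induction "is")
  case (Cons a js)
  have "(\<Sum>i\<in>K. int (count_list (a # js) i)) = (\<Sum>i\<in>K. (if a = i then 1 else 0) + int (count_list js i))"
    by (intro sum.cong) auto
  then show ?case using Cons by (simp add: sum.distrib)
qed simp

text \<open>Some root vector for \<beta> is a word with exactly one letter outside \<open>J\<close>.
  A first letter in \<open>J\<close> is simply dropped. If the first letter is the one outside, the
  bracket is reversed and \<open>bracket_word_nonzero\<close> removes one of the others.\<close>

lemma nonsimple_root_descends:
  assumes \<beta>: "\<beta> \<in> roots_ht1 \<iota> \<alpha> (- J)" "\<beta> \<notin> \<alpha> ` (- J)"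
  shows "\<exists>j\<in>J. \<beta> - \<alpha> j \<in> wt \<iota> bracket"
proof -
  obtain n where n: "\<beta> = rt \<alpha> n" "\<And>i. n i \<ge> 0" "\<beta> \<in> wt \<iota> bracket" "(\<Sum>i\<in>- J. n i) = 1"
    using \<beta>(1) by (rule roots_ht1_cases) blast
  obtain x where x: "x \<in> weight_space \<iota> bracket \<beta>" "x \<noteq> 0" "\<beta> \<in> dual" using n(3) by (rule adj.wtE)
  have dual: "\<beta> - \<alpha> j \<in> dual" for j using x(3) by (simp only: dual_closed root_dual)
  from x(1,2) show ?thesis
  proof (cases rule: root_space_cases)
    case zero
    then show ?thesis using n(1,4) rt_eq_0 by auto
  next
    case (neg js k)
    then have "n = (\<lambda>i. - int (count_list (js @ [k]) i))"
      unfolding n(1) sum_list_eq_rt rt_uminus[symmetric] rt_inj by blast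
    then have "(\<Sum>i\<in>- J. n i) \<le> 0" by (intro sum_nonpos) simp
    then show ?thesis using n(4) by simp
  next
    case (pos js k)
    then have "n = (\<lambda>i. int (count_list (js @ [k]) i))"
      unfolding n(1) sum_list_eq_rt rt_inj by blast
    then have len: "length (filter (\<lambda>i. i \<in> - J) (js @ [k])) = 1"
      using n(4) sum_count_list[of "- J" "js @ [k]"] by simp
    show ?thesis
    proof (cases js)
      case Nil
      then show ?thesis using len pos(1) \<beta>(2) by (auto split: if_splits)
    next
      case (Cons i ks)
      let ?y = "word bracket e ks (e k)"
      have y: "bracket (e i) ?y \<noteq> 0" using pos(2) Cons by simp
      have eq: "\<beta> = \<alpha> i + sum_list (map \<alpha> (ks @ [k]))" using pos(1) Cons by simp
      show ?thesis
      proof (cases "i \<in> J")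
        case True
        have "?y \<noteq> 0" using y by auto
        moreover have "?y \<in> weight_space \<iota> bracket (\<beta> - \<alpha> i)"
          using e_word_weight[of ks k] unfolding eq by (simp only: add_diff_cancel_left')
        ultimately show ?thesis using True adj.wtI dual by blast
      next
        case False
        then have "set (ks @ [k]) \<subseteq> J"
          using len Cons by (auto simp: filter_empty_conv split: if_splits)
        moreover have "bracket ?y (e i) \<noteq> 0" using y bracket_anti[of ?y "e i"] by simp
        ultimately show ?thesis
          using bracket_word_nonzero[OF e_weight, of ks k i] adj.wtI dual unfolding eq by blast
      qed
    qed
  qed
qed

end

section \<open>Highest weight modules\<close>

locale highest_weight = kac_moody_algebra A coroot \<alpha> \<iota> e f + lie_rep act
  for A :: "int ^ 'i::finite ^ 'i"
    and coroot :: "'i \<Rightarrow> 'h::complex_vector"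
    and \<alpha> :: "'i \<Rightarrow> 'h \<Rightarrow> complex"
    and \<iota> :: "'h \<Rightarrow> 'g::complex_lie_algebra"
    and e f :: "'i \<Rightarrow> 'g"
    and act :: "'g \<Rightarrow> 'v::complex_vector \<Rightarrow> 'v" +
  fixes lam :: "'h \<Rightarrow> complex" and v :: 'v
  assumes lam_dual: "lam \<in> dual"
    and v_weight: "v \<in> weight_space \<iota> act lam"
    and e_v: "act (e i) v = 0"
    and v_generates: "generated_submodule act {v} = UNIV"
    and v_nonzero: "v \<noteq> 0"
begin

lemma span_words: "complex_vector.span {word act f is v | is. True} = UNIV"
proof -
  let ?W = "complex_vector.span {word act f is v | is. True}"
  have "word act f [] v \<in> ?W" by (rule complex_vector.span_base) blast
  moreover have "submodule act ?W"
    unfolding submodule_def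
    using word_ideal[OF lie_rep_axioms v_weight e_v] complex_vector.subspace_span by blast
  ultimately have "generated_submodule act {v} \<subseteq> ?W" by (auto simp: generated_submodule_def)
  then show ?thesis using v_generates by auto
qed

lemma f_word_lower:
  assumes "x \<in> weight_space \<iota> act \<mu>"
  shows "word act f is x \<in> weight_space \<iota> act (\<mu> - sum_list (map \<alpha> is))"
proof -
  have "sum_list (map (\<lambda>i. - \<alpha> i) is) = - sum_list (map \<alpha> is)" for "is" by (induction "is") auto
  then show ?thesis using word_weight_space[where x = f, OF f_weight assms, of "is"] by simp
qed

lemma weights_words:
  assumes "\<mu> \<in> wt \<iota> act"
  obtains "is" where "\<mu> = lam - sum_list (map \<alpha> is)" "word act f is v \<noteq> 0"
proof -
  obtain x where x: "x \<in> weight_space \<iota> act \<mu>" "x \<noteq> 0" using assms by (rule wtE)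
  have ex: "\<exists>\<nu>. y \<in> weight_space \<iota> act \<nu>" if "y \<in> {word act f is v | is. True}" for y
    using that f_word_lower[OF v_weight] by blast
  have "x \<in> complex_vector.span {word act f is v | is. True}" using span_words by simp
  from weight_vector_in_span[OF ex this x] obtain js
    where js: "word act f js v \<noteq> 0" "word act f js v \<in> weight_space \<iota> act \<mu>" by blast
  from weight_space_unique[OF js(2) f_word_lower[OF v_weight] js(1)] js(1) that show thesis by blast
qed

lemma lower_dual: "lam - rt \<alpha> n \<in> dual"
  using lam_dual by (simp only: dual_closed rt_dual)

lemma weights_rt:
  assumes "\<mu> \<in> wt \<iota> act"
  obtains n where "\<mu> = lam - rt \<alpha> n" "\<And>i. n i \<ge> 0"
  using assms by (rule weights_words) (metis of_nat_0_le_iff sum_list_eq_rt that)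

lemma wt_of_rt:
  "lam - rt \<alpha> n \<in> wt_of \<iota> \<alpha> act lam J \<longleftrightarrow> lam - rt \<alpha> n \<in> wt \<iota> act \<and> (\<forall>i. i \<notin> J \<longrightarrow> n i = 0)"
proof -
  have "n i = 0" if "lam - rt \<alpha> n = lam - sum_list (map \<alpha> is)" "set is \<subseteq> J" "i \<notin> J" for "is" i
  proof -
    have "rt \<alpha> n = rt \<alpha> (\<lambda>i. int (count_list is i))" using that(1) by (simp only: sum_list_eq_rt diff_left_eq_iff)
    then show ?thesis using that(2,3) unfolding rt_inj by (auto simp: count_list_0_iff)
  qed
  moreover have "\<exists>is. set is \<subseteq> J \<and> lam - rt \<alpha> n = lam - sum_list (map \<alpha> is)"
    if "lam - rt \<alpha> n \<in> wt \<iota> act" and 0: "\<forall>i. i \<notin> J \<longrightarrow> n i = 0"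
  proof -
    obtain js where js: "lam - rt \<alpha> n = lam - sum_list (map \<alpha> js)" using \<open>_ \<in> wt \<iota> act\<close> by (rule weights_words)
    then have "n = (\<lambda>i. int (count_list js i))"
      by (simp only: sum_list_eq_rt diff_left_eq_iff rt_inj)
    then have "set js \<subseteq> J" using 0 count_list_0_iff[of js] by auto
    then show ?thesis using js by blast
  qed
  ultimately show ?thesis
    unfolding wt_of_def nat_combs_image by (auto simp: minkowski_diff_iff)
qed

text \<open>Otherwise \<mu> could be raised by \<alpha> j indefinitely, although no weight exceeds
  \<open>lam\<close> in its coordinate at \<open>j\<close>.\<close>

lemma e_locally_nilpotent:
  assumes x: "x \<in> weight_space \<iota> act \<mu>"
  shows "\<exists>n. (act (e j) ^^ n) x = 0"
proof (rule ccontr)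
  assume "\<not> ?thesis"
  then have nz: "(act (e j) ^^ n) x \<noteq> 0" for n by blast
  have wt: "(act (e j) ^^ n) x \<in> weight_space \<iota> act (of_nat n *\<^sub>C \<alpha> j + \<mu>)" for n
    by (rule funpow_weight_space[OF e_weight x])
  have spanx: "y \<in> complex_vector.span {word act f is v | is. True}" for y using span_words by simp
  have ex: "\<exists>\<nu>. y \<in> weight_space \<iota> act \<nu>" if "y \<in> {word act f is v | is. True}" for y
    using that f_word_lower[OF v_weight] by blast
  have lower: "\<exists>m. of_nat n *\<^sub>C \<alpha> j + \<mu> = lam - rt \<alpha> m \<and> (\<forall>i. m i \<ge> 0)" for n
  proof -
    obtain js where js: "word act f js v \<noteq> 0" "word act f js v \<in> weight_space \<iota> act (of_nat n *\<^sub>C \<alpha> j + \<mu>)"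
      using weight_vector_in_span[OF ex spanx wt nz] by blast
    from weight_space_unique[OF js(2) f_word_lower[OF v_weight] js(1)] show ?thesis
      unfolding sum_list_eq_rt by (metis of_nat_0_le_iff)
  qed
  obtain m where m: "\<mu> = lam - rt \<alpha> m" using lower[of 0] by auto
  let ?n = "Suc (nat (m j))"
  obtain m' where m': "of_nat ?n *\<^sub>C \<alpha> j + \<mu> = lam - rt \<alpha> m'" "\<And>i. m' i \<ge> 0" using lower[of ?n] by blast
  have "rt \<alpha> m' = rt \<alpha> m - of_nat ?n *\<^sub>C \<alpha> j" using m'(1) m by (simp add: algebra_simps)
  then have "m' = (\<lambda>i. m i - (if i = j then int ?n else 0))"
    by (simp only: scale_\<alpha>_rt rt_diff[symmetric] rt_inj)
  then have "m' j < 0" by simp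
  then show False using m'(2)[of j] by simp
qed

text \<open>A vector of weight \<mu> is killed by \<open>f j\<close>, so it is singular for the sl2
  triple with \<open>e j\<close> and \<open>f j\<close> exchanged. Local nilpotency of
  \<open>e j\<close> then gives \<open>sl2_string_finite\<close>.\<close>

lemma string_lowest:
  assumes \<mu>: "\<mu> \<in> wt \<iota> act" and low: "\<mu> - \<alpha> j \<notin> wt \<iota> act"
  obtains m where "\<mu> (coroot j) = - of_nat m" "\<mu> + of_nat m *\<^sub>C \<alpha> j \<in> wt \<iota> act"
proof -
  obtain x where x: "x \<in> weight_space \<iota> act \<mu>" "x \<noteq> 0" "\<mu> \<in> dual" using \<mu> by (rule wtE)
  have "act (f j) x = 0"
  proof (rule ccontr)
    assume nz: "act (f j) x \<noteq> 0"
    have "act (f j) x \<in> weight_space \<iota> act (\<mu> - \<alpha> j)" using f_word_lower[OF x(1), of "[j]"] by simp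
    then have "\<mu> - \<alpha> j \<in> wt \<iota> act" by (rule wtI[OF _ nz]) (simp only: dual_closed x(3) root_dual)
    then show False using low by contradiction
  qed
  moreover have "bracket (f j) (e j) = - \<iota> (coroot j)"
    "bracket (- \<iota> (coroot j)) (e j) = - (2 *\<^sub>C e j)"
    by (simp_all add: bracket_anti[of "f j"] bracket_e_f bracket_h_e pairing diag)
  moreover have "act (- \<iota> (coroot j)) x = (- \<mu> (coroot j)) *\<^sub>C x"
    by (simp add: weight_spaceD[OF x(1)])
  moreover obtain n where "(act (e j) ^^ n) x = 0" using e_locally_nilpotent[OF x(1)] by blast
  ultimately obtain m where m: "- \<mu> (coroot j) = of_nat m" "(act (e j) ^^ m) x \<noteq> 0"
    using sl2_string_finite[of "f j" "e j" "- \<iota> (coroot j)" x] x(2) by blast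
  show thesis
  proof (rule that)
    show "\<mu> (coroot j) = - of_nat m" using m(1) by (metis minus_minus)
    have "of_nat m *\<^sub>C \<alpha> j + \<mu> \<in> wt \<iota> act"
      by (rule wtI[OF funpow_weight_space[OF e_weight x(1)] m(2)]) (simp only: dual_closed x(3) root_dual)
    then show "\<mu> + of_nat m *\<^sub>C \<alpha> j \<in> wt \<iota> act" by (simp only: add.commute)
  qed
qed

text \<open>The closure is taken in the mirrored algebra, whose raising operators are the
  \<open>f j\<close>. Its span thus contains all words in the \<open>f\<close> applied to
  \<open>v\<close>, hence the whole module.\<close>

lemma weights_upper_bound:
  "wt \<iota> act \<subseteq> wt_of \<iota> \<alpha> act lam J \<ominus> nat_combs (roots_ht1 \<iota> \<alpha> (- J))"
proof
  interpret sw: kac_moody_algebra A coroot \<alpha> "\<lambda>h. - \<iota> h" f e by (rule swap_kac_moody)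
  let ?D = "roots_ht1 \<iota> \<alpha> (- J)"
  let ?B = "{b. \<exists>is. set is \<subseteq> J \<and> b \<in> weight_space \<iota> act (lam - sum_list (map \<alpha> is))}"
  let ?X = "ht1_closure (\<lambda>h. - \<iota> h) \<alpha> act J ?B"
  have Bclosed: "act (f j) b \<in> ?B" if j: "j \<in> J" and b: "b \<in> ?B" for j b
  proof -
    obtain ks where ks: "set ks \<subseteq> J" "b \<in> weight_space \<iota> act (lam - sum_list (map \<alpha> ks))" using b by blast
    have "lam - sum_list (map \<alpha> ks) - sum_list (map \<alpha> [j]) = lam - sum_list (map \<alpha> (j # ks))"
      by (simp add: algebra_simps)
    then have "act (f j) b \<in> weight_space \<iota> act (lam - sum_list (map \<alpha> (j # ks)))"
      using f_word_lower[OF ks(2), of "[j]"] by (simp only: word_simps)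
    moreover have "set (j # ks) \<subseteq> J" using j ks(1) by simp
    ultimately show ?thesis by blast
  qed
  have vB: "v \<in> ?B" using v_weight by (auto intro: exI[of _ "[]"])
  have word: "word act f is v \<in> complex_vector.span ?X" for "is"
    by (rule sw.e_word_closed)
      (use vB in \<open>auto intro: sw.ht1_closure_act[OF lie_rep_axioms Bclosed] complex_vector.span_base ht1_closure.base\<close>)
  then have "complex_vector.span {word act f is v | is. True} \<subseteq> complex_vector.span ?X"
    by (intro complex_vector.span_minimal complex_vector.subspace_span) blast
  then have span: "y \<in> complex_vector.span ?X" for y using span_words by auto
  \<comment> \<open>The condition \<open>y \<noteq> 0\<close> is there because a zero vector in
    \<open>?B\<close> yields no weight. It passes on, since a nonzero \<open>act z y\<close> has a
    nonzero \<open>y\<close>.\<close>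
  have wt: "\<exists>\<mu> \<gamma>. y \<in> weight_space \<iota> act (\<mu> - \<gamma>) \<and> \<gamma> \<in> nat_combs ?D
      \<and> (y \<noteq> 0 \<longrightarrow> \<mu> \<in> wt_of \<iota> \<alpha> act lam J)" if "y \<in> ?X" for y
    using that
  proof induction
    case (base b)
    then obtain ks where ks: "set ks \<subseteq> J" "b \<in> weight_space \<iota> act (lam - sum_list (map \<alpha> ks))" by blast
    let ?\<mu> = "lam - sum_list (map \<alpha> ks)"
    have "?\<mu> \<in> wt_of \<iota> \<alpha> act lam J" if "b \<noteq> 0"
    proof -
      have "?\<mu> \<in> wt \<iota> act"
        by (rule wtI[OF ks(2) that]) (simp only: sum_list_eq_rt lower_dual)
      moreover have "?\<mu> \<in> {lam} \<ominus> nat_combs (\<alpha> ` J)"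
        using ks(1) unfolding nat_combs_image minkowski_diff_def by blast
      ultimately show ?thesis by (simp add: wt_of_def)
    qed
    moreover have "b \<in> weight_space \<iota> act (?\<mu> - 0)" using ks(2) by simp
    ultimately show ?case using nat_combs_zero by blast
  next
    case (step z \<beta> y)
    then obtain \<mu> \<gamma> where IH: "y \<in> weight_space \<iota> act (\<mu> - \<gamma>)" "\<gamma> \<in> nat_combs ?D"
        "y \<noteq> 0 \<longrightarrow> \<mu> \<in> wt_of \<iota> \<alpha> act lam J" by blast
    have \<beta>: "\<beta> \<in> ?D" using step.hyps(2) unfolding roots_ht1_uminus .
    have "z \<in> weight_space \<iota> bracket (- \<beta>)" using step.hyps(1) unfolding adj.weight_space_uminus .
    from act_weight_space[OF this IH(1)] have "act z y \<in> weight_space \<iota> act (\<mu> - (\<beta> + \<gamma>))"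
      by (simp add: algebra_simps)
    moreover have "\<beta> + \<gamma> \<in> nat_combs ?D" using nat_combs_add[OF nat_combs_base[OF \<beta>] IH(2)] .
    moreover have "act z y \<noteq> 0 \<longrightarrow> y \<noteq> 0" by auto
    ultimately show ?case using IH(3) by blast
  qed
  have ex: "\<exists>\<nu>. y \<in> weight_space \<iota> act \<nu>" if "y \<in> ?X" for y
    using wt[OF that] by blast
  fix \<mu> assume "\<mu> \<in> wt \<iota> act"
  then obtain x where x: "x \<in> weight_space \<iota> act \<mu>" "x \<noteq> 0" by (rule wtE)
  from weight_vector_in_span[OF ex span x] obtain y
    where y: "y \<in> ?X" "y \<noteq> 0" "y \<in> weight_space \<iota> act \<mu>" by blast
  obtain \<mu>' \<gamma> where w: "y \<in> weight_space \<iota> act (\<mu>' - \<gamma>)" "\<gamma> \<in> nat_combs ?D"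
      "y \<noteq> 0 \<longrightarrow> \<mu>' \<in> wt_of \<iota> \<alpha> act lam J" using wt[OF y(1)] by blast
  have "\<mu> = \<mu>' - \<gamma>" using weight_space_unique[OF y(3) w(1) y(2)] .
  then show "\<mu> \<in> wt_of \<iota> \<alpha> act lam J \<ominus> nat_combs ?D"
    using w y(2) unfolding minkowski_diff_iff by blast
qed

text \<open>The induction runs over \<open>N\<close>, the height over \<open>J\<close> of the sum of
  \<open>bs\<close>, for all \<mu> at once because \<mu> may have to move along its string.\<close>

lemma weights_lower_bound:
  assumes hyp: "wt_of \<iota> \<alpha> act lam J \<ominus> nat_combs (\<alpha> ` (- J)) \<subseteq> wt \<iota> act"
  shows "set bs \<subseteq> roots_ht1 \<iota> \<alpha> (- J) \<Longrightarrow> \<mu> \<in> wt_of \<iota> \<alpha> act lam J \<Longrightarrow> \<mu> - sum_list bs \<in> wt \<iota> act"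
proof -
  let ?D = "roots_ht1 \<iota> \<alpha> (- J)" and ?W = "wt_of \<iota> \<alpha> act lam J"
  have coords: "\<exists>m. sum_list bs = rt \<alpha> m \<and> (\<forall>i. m i \<ge> 0)" if "set bs \<subseteq> ?D" for bs
    using that
  proof (induction bs)
    case Nil
    then show ?case by (intro exI[of _ "\<lambda>_. 0"]) (simp add: rt_def)
  next
    case (Cons \<beta> bs)
    then obtain m where m: "sum_list bs = rt \<alpha> m" "\<forall>i. m i \<ge> 0" by auto
    have "\<beta> \<in> ?D" using Cons.prems by simp
    then obtain n where n: "\<beta> = rt \<alpha> n" "\<And>i. n i \<ge> 0" by (rule roots_ht1_cases) blast
    show ?case using m n by (intro exI[of _ "\<lambda>i. n i + m i"]) (simp add: rt_add)
  qed
  have "\<mu> - sum_list bs \<in> wt \<iota> act"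
    if "set bs \<subseteq> ?D" "\<mu> \<in> ?W" "sum_list bs = rt \<alpha> m" "nat (\<Sum>i\<in>J. m i) = N" for N m bs \<mu>
    using that
  proof (induction N arbitrary: bs m \<mu> rule: less_induct)
    case (less N)
    show ?case
    proof (cases "set bs \<subseteq> \<alpha> ` (- J)")
      case True
      then have "sum_list bs \<in> nat_combs (\<alpha> ` (- J))" unfolding nat_combs_eq by blast
      then show ?thesis using hyp less.prems(2) unfolding minkowski_diff_def by blast
    next
      case False
      then obtain \<beta>\<^sub>1 where \<beta>\<^sub>1: "\<beta>\<^sub>1 \<in> set bs" "\<beta>\<^sub>1 \<notin> \<alpha> ` (- J)" by blast
      then obtain j where j: "j \<in> J" "\<beta>\<^sub>1 - \<alpha> j \<in> wt \<iota> bracket"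
        using nonsimple_root_descends less.prems(1) by blast
      obtain p where p: "\<And>\<beta>. \<beta> \<in> ?D \<Longrightarrow> \<beta> - of_nat (p \<beta>) *\<^sub>C \<alpha> j \<in> ?D
          \<and> (\<exists>c. \<beta> (coroot j) = of_int c \<and> c \<le> int (p \<beta>)) \<and> (\<beta> - \<alpha> j \<in> wt \<iota> bracket \<longrightarrow> p \<beta> \<ge> 1)"
        using root_step[OF _ j(1)] by metis
      let ?bs = "map (\<lambda>\<beta>. \<beta> - of_nat (p \<beta>) *\<^sub>C \<alpha> j) bs" and ?s = "sum_list bs"
      define P where "P = sum_list (map p bs)"
      have "p \<beta>\<^sub>1 \<ge> 1" using p \<beta>\<^sub>1(1) less.prems(1) j(2) by blast
      moreover have "p \<beta>\<^sub>1 \<le> P" unfolding P_def using \<beta>\<^sub>1(1) by (intro member_le_sum_list) auto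
      ultimately have P: "P \<ge> 1" by simp
      have bs': "set ?bs \<subseteq> ?D" using p less.prems(1) by auto
      have sum_bs: "sum_list ?bs = ?s - of_nat P *\<^sub>C \<alpha> j"
        unfolding P_def by (induction bs) (simp_all add: scaleC_add_left algebra_simps)
      \<comment> \<open>The bounds from \<open>root_step\<close> add up to
        \<open>C \<le> int P\<close>, which makes the strings used below long enough.\<close>
      have "\<exists>c. ?s (coroot j) = of_int c \<and> c \<le> int P"
        using less.prems(1) unfolding P_def
      proof (induction bs)
        case (Cons \<beta> bs)
        then obtain c where c: "sum_list bs (coroot j) = of_int c" "c \<le> int (sum_list (map p bs))" by auto
        obtain d where "\<beta> (coroot j) = of_int d" "d \<le> int (p \<beta>)" using p Cons.prems by auto
        then show ?case using c by (intro exI[of _ "d + c"]) simp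
      qed auto
      then obtain C where C: "?s (coroot j) = of_int C" "C \<le> int P" by blast
      \<comment> \<open>The shifted list has height smaller by \<open>P\<close>, and
        \<open>P \<ge> 1\<close> thanks to \<open>\<beta>\<^sub>1\<close>. Nonnegativity of the new
        coordinates makes the decrease survive \<open>nat\<close>.\<close>
      have IH: "\<mu>' - ?s + of_nat P *\<^sub>C \<alpha> j \<in> wt \<iota> act" if "\<mu>' \<in> ?W" for \<mu>'
      proof -
        obtain m' where m': "sum_list ?bs = rt \<alpha> m'" "\<forall>i. m' i \<ge> 0" using coords[OF bs'] by blast
        have "rt \<alpha> m' = rt \<alpha> m - of_nat P *\<^sub>C \<alpha> j"
          using m'(1) sum_bs less.prems(3) by (simp only:)
        then have "m' = (\<lambda>i. m i - (if i = j then int P else 0))"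
          by (simp only: scale_\<alpha>_rt rt_diff[symmetric] rt_inj)
        then have "(\<Sum>i\<in>J. m' i) = (\<Sum>i\<in>J. m i) - int P"
          using j(1) by (simp add: sum_subtractf)
        moreover have "(\<Sum>i\<in>J. m' i) \<ge> 0" using m'(2) by (simp add: sum_nonneg)
        ultimately have "nat (\<Sum>i\<in>J. m' i) < N" using P less.prems(4) by linarith
        from less.IH[OF this bs' that m'(1) refl] show ?thesis by (simp only: sum_bs diff_diff_eq2 diff_add_eq)
      qed
      obtain n where n: "\<mu> = lam - rt \<alpha> n"
        using less.prems(2) unfolding wt_of_def by (blast elim: weights_rt)
      \<comment> \<open>As \<open>j\<close> lies in \<open>J\<close>, a shift by multiples of
        \<open>\<alpha> j\<close> changes no coordinate outside \<open>J\<close>.\<close>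
      have shift: "\<mu> - of_int k *\<^sub>C \<alpha> j \<in> ?W \<longleftrightarrow> \<mu> - of_int k *\<^sub>C \<alpha> j \<in> wt \<iota> act" for k :: int
      proof -
        have "of_int k *\<^sub>C \<alpha> j = rt \<alpha> (\<lambda>i. if i = j then k else 0)" by (simp add: rt_single)
        then have eq: "\<mu> - of_int k *\<^sub>C \<alpha> j = lam - rt \<alpha> (\<lambda>i. n i + (if i = j then k else 0))"
          unfolding rt_add n by (simp add: algebra_simps)
        have "\<forall>i. i \<notin> J \<longrightarrow> n i = 0" using less.prems(2) unfolding n wt_of_rt by blast
        then show ?thesis unfolding eq wt_of_rt using j(1) by auto
      qed
      have down: "T - of_nat t *\<^sub>C \<alpha> j \<in> wt \<iota> act"
        if "T \<in> wt \<iota> act" "T (coroot j) = of_int q" "int t \<le> q" for T t q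
        using string_down[OF lie_rep_axioms that(1), of j "nat q" t, OF _ _ e_locally_nilpotent] that(2,3)
        by simp
      show ?thesis
      \<comment> \<open>If \<mu> can be lowered by \<open>P\<close> steps within \<open>?W\<close>,
        the two shifts by \<open>P\<close> cancel. Otherwise the string below \<mu> has a
        gap.\<close>
      proof (cases "\<mu> - of_int (int P) *\<^sub>C \<alpha> j \<in> ?W")
        case True
        have "\<mu> - of_int (int P) *\<^sub>C \<alpha> j - ?s + of_nat P *\<^sub>C \<alpha> j = \<mu> - ?s"
          by (simp add: fun_eq_iff)
        with IH[OF True] show ?thesis by metis
      next
        case False
        \<comment> \<open>The gap is first met at step \<open>q\<close>, so
          \<open>string_lowest\<close> applies one step earlier, at \<open>r\<close>; it shows that
          \<mu> pairs to \<open>2 * r - l\<close> with the coroot.\<close>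
        define q where "q = (LEAST q. \<mu> - of_int (int q) *\<^sub>C \<alpha> j \<notin> ?W)"
        have q: "\<mu> - of_int (int q) *\<^sub>C \<alpha> j \<notin> ?W"
          unfolding q_def using False by (rule LeastI)
        have "q \<noteq> 0" using q less.prems(2) by (intro notI) simp
        then obtain r where r: "q = Suc r" by (cases q) auto
        have "r < q" by (simp add: r)
        from not_less_Least[OF this[unfolded q_def]] have rW: "\<mu> - of_int (int r) *\<^sub>C \<alpha> j \<in> ?W" by simp
        have "\<mu> - of_int (int r) *\<^sub>C \<alpha> j - \<alpha> j = \<mu> - of_int (int q) *\<^sub>C \<alpha> j"
          by (simp add: r fun_eq_iff scaleC_add_left scaleC_one)
        then have "\<mu> - of_int (int r) *\<^sub>C \<alpha> j - \<alpha> j \<notin> wt \<iota> act" using q shift by metis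
        moreover have "\<mu> - of_int (int r) *\<^sub>C \<alpha> j \<in> wt \<iota> act" using rW shift by blast
        ultimately obtain l where l: "(\<mu> - of_int (int r) *\<^sub>C \<alpha> j) (coroot j) = - of_nat l"
            "\<mu> - of_int (int r) *\<^sub>C \<alpha> j + of_nat l *\<^sub>C \<alpha> j \<in> wt \<iota> act"
          using string_lowest by metis
        have \<mu>j: "\<mu> (coroot j) = of_int (2 * int r - int l)"
          using l(1) by (simp add: scaleC_fun_def scaleC_complex_def pairing diag algebra_simps)
        show ?thesis
        proof (cases "l \<le> 2 * r")
          case True
          \<comment> \<open>Here \<mu> pairs to a nonnegative number, so by
            \<open>C \<le> int P\<close> the pairing of \<open>?T\<close> is at least
            \<open>P\<close>, enough for \<open>P\<close> steps down.\<close>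
          let ?T = "\<mu> - ?s + of_nat P *\<^sub>C \<alpha> j"
          have "?T (coroot j) = of_int (2 * int r - int l - C + 2 * int P)"
            using \<mu>j C(1) by (simp add: scaleC_fun_def scaleC_complex_def pairing diag)
          then have "?T - of_nat P *\<^sub>C \<alpha> j \<in> wt \<iota> act"
            by (rule down[OF IH[OF less.prems(2)]]) (use True C(2) in linarith)
          then show ?thesis by (simp only: add_diff_cancel)
        next
          case False
          \<comment> \<open>The weight supplied by \<open>string_lowest\<close> replaces \<mu>. It
            pairs to \<open>l\<close>, so \<open>?T\<close> pairs to at least \<open>l + P\<close>,
            enough for the \<open>l - r + P\<close> steps down to the target.\<close>
          let ?\<mu> = "\<mu> - of_int (int r - int l) *\<^sub>C \<alpha> j"
          have "?\<mu> = \<mu> - of_int (int r) *\<^sub>C \<alpha> j + of_nat l *\<^sub>C \<alpha> j"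
            by (simp add: complex_vector.scale_left_diff_distrib)
          then have \<mu>': "?\<mu> \<in> ?W" using l(2) shift by metis
          let ?T = "?\<mu> - ?s + of_nat P *\<^sub>C \<alpha> j"
          have "?T (coroot j) = of_int (int l - C + 2 * int P)"
            using \<mu>j C(1) by (simp add: scaleC_fun_def scaleC_complex_def pairing diag algebra_simps)
          then have "?T - of_nat (l - r + P) *\<^sub>C \<alpha> j \<in> wt \<iota> act"
            by (rule down[OF IH[OF \<mu>']]) (use False C(2) in linarith)
          also have "?T - of_nat (l - r + P) *\<^sub>C \<alpha> j = \<mu> - ?s"
            using False by (simp add: scaleC_fun_def scaleC_complex_def fun_eq_iff of_nat_diff algebra_simps)
          finally show ?thesis .
        qed
      qed
    qed
  qed
  then show "set bs \<subseteq> ?D \<Longrightarrow> \<mu> \<in> ?W \<Longrightarrow> \<mu> - sum_list bs \<in> wt \<iota> act"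
    using coords by blast
qed

lemma weights_eq_iff:
  "wt_of \<iota> \<alpha> act lam J \<ominus> nat_combs (\<alpha> ` (- J)) \<subseteq> wt \<iota> act
    \<longleftrightarrow> wt \<iota> act = wt_of \<iota> \<alpha> act lam J \<ominus> nat_combs (roots_ht1 \<iota> \<alpha> (- J))"
proof
  assume hyp: "wt_of \<iota> \<alpha> act lam J \<ominus> nat_combs (\<alpha> ` (- J)) \<subseteq> wt \<iota> act"
  have "wt_of \<iota> \<alpha> act lam J \<ominus> nat_combs (roots_ht1 \<iota> \<alpha> (- J)) \<subseteq> wt \<iota> act"
    using weights_lower_bound[OF hyp] unfolding nat_combs_eq minkowski_diff_def by blast
  then show "wt \<iota> act = wt_of \<iota> \<alpha> act lam J \<ominus> nat_combs (roots_ht1 \<iota> \<alpha> (- J))"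
    using weights_upper_bound by blast
next
  assume eq: "wt \<iota> act = wt_of \<iota> \<alpha> act lam J \<ominus> nat_combs (roots_ht1 \<iota> \<alpha> (- J))"
  have "nat_combs (\<alpha> ` (- J)) \<subseteq> nat_combs (roots_ht1 \<iota> \<alpha> (- J))"
    by (rule nat_combs_subset) (auto intro: nat_combs_base simple_roots_ht1)
  then show "wt_of \<iota> \<alpha> act lam J \<ominus> nat_combs (\<alpha> ` (- J)) \<subseteq> wt \<iota> act"
    unfolding eq minkowski_diff_def by blast
qed

section \<open>The radical and injectivity of lowering operators\<close>

definition lower :: "'v set"
  where "lower = complex_vector.span {word act f is v | is. is \<noteq> []}"

lemma lower_subspace: "complex_vector.subspace lower"
  by (simp add: lower_def complex_vector.subspace_span)

lemma f_lower: "act (f i) y \<in> lower"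
proof -
  have "y \<in> complex_vector.span {word act f is v | is. True}" using span_words by simp
  then show ?thesis
    unfolding lower_def
  proof (rule act_span[rotated])
    fix x assume "x \<in> {word act f is v | is. True}"
    then obtain js where "x = word act f js v" by blast
    then have "act (f i) x = word act f (i # js) v" by simp
    then show "act (f i) x \<in> complex_vector.span {word act f is v | is. is \<noteq> []}"
      by (intro complex_vector.span_base) blast
  qed
qed

lemma h_lower:
  assumes "y \<in> lower" shows "act (\<iota> h) y \<in> lower"
  using assms unfolding lower_def
proof (rule act_span[rotated])
  fix x assume "x \<in> {word act f is v | is. is \<noteq> []}"
  then obtain js where js: "x = word act f js v" and x: "x \<in> {word act f is v | is. is \<noteq> []}" by blast
  show "act (\<iota> h) x \<in> complex_vector.span {word act f is v | is. is \<noteq> []}"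
    using complex_vector.span_scale[OF complex_vector.span_base[OF x]]
    unfolding js weight_spaceD[OF f_word_lower[OF v_weight]] .
qed

lemma highest_weight_vector_lower:
  assumes "y \<in> lower" "y \<in> weight_space \<iota> act lam"
  shows "y = 0"
proof (rule ccontr)
  assume nz: "y \<noteq> 0"
  have ex: "\<exists>\<nu>. x \<in> weight_space \<iota> act \<nu>" if "x \<in> {word act f is v | is. is \<noteq> []}" for x
    using that f_word_lower[OF v_weight] by blast
  from weight_vector_in_span[OF ex assms(1)[unfolded lower_def] assms(2) nz] obtain js
    where js: "js \<noteq> []" "word act f js v \<noteq> 0" "word act f js v \<in> weight_space \<iota> act lam" by blast
  have "lam = lam - sum_list (map \<alpha> js)"
    using weight_space_unique[OF js(3) f_word_lower[OF v_weight] js(2)] .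
  then have "sum_list (map \<alpha> js) = 0" by (metis diff_left_eq_iff diff_zero)
  then show False using sum_list_roots_nonzero[OF js(1)] by contradiction
qed

text \<open>The module is the sum of \<open>lower\<close> and the line through \<open>v\<close>, so
  \<open>z\<close> has a nonzero component \<open>c\<close> along \<open>v\<close>. If \<nu> were
  not \<open>lam\<close>, then \<open>c *\<^sub>C v\<close> would be a combination of vectors of
  other weights.\<close>

lemma not_lower_highest:
  assumes z: "z \<notin> lower" "z \<in> weight_space \<iota> act \<nu>"
  obtains c where "\<nu> = lam" "z = c *\<^sub>C v" "c \<noteq> 0"
proof -
  let ?L = "{word act f is v | is. is \<noteq> []}"
  have "{word act f is v | is. True} \<subseteq> insert v ?L"
  proof
    fix x assume "x \<in> {word act f is v | is. True}"
    then obtain js where "x = word act f js v" by blast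
    then show "x \<in> insert v ?L" by (cases "js = []") auto
  qed
  then have "complex_vector.span {word act f is v | is. True} \<subseteq> complex_vector.span (insert v ?L)"
    by (rule complex_vector.span_mono)
  then have "z \<in> complex_vector.span (insert v ?L)" using span_words by auto
  then obtain c where c: "z - c *\<^sub>C v \<in> lower"
    unfolding complex_vector.span_breakdown_eq lower_def by blast
  have c0: "c \<noteq> 0" using c z(1) by auto
  have \<nu>: "\<nu> = lam"
  proof (rule ccontr)
    assume "\<nu> \<noteq> lam"
    have ex: "\<exists>\<nu>. x \<in> weight_space \<iota> act \<nu>" if "x \<in> insert z ?L" for x
      using that f_word_lower[OF v_weight] z(2) by blast
    have "complex_vector.span ?L \<subseteq> complex_vector.span (insert z ?L)"
      by (rule complex_vector.span_mono) blast
    then have "z - c *\<^sub>C v \<in> complex_vector.span (insert z ?L)"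
      using c unfolding lower_def by blast
    moreover have "z \<in> complex_vector.span (insert z ?L)"
      by (rule complex_vector.span_base) blast
    ultimately have "z - (z - c *\<^sub>C v) \<in> complex_vector.span (insert z ?L)"
      by (rule complex_vector.span_diff[rotated])
    then have cv: "c *\<^sub>C v \<in> complex_vector.span (insert z ?L)"
      by (simp only: diff_diff_eq2 add_diff_cancel_left')
    have "c *\<^sub>C v \<in> weight_space \<iota> act lam"
      using v_weight by (rule complex_vector.subspace_scale[OF weight_space_subspace])
    from weight_vector_in_span[OF ex cv this] c0 v_nonzero
    obtain y where y: "y \<in> insert z ?L" "y \<noteq> 0" "y \<in> weight_space \<iota> act lam" by auto
    have "y \<noteq> z" using weight_space_unique[OF _ z(2)] y \<open>\<nu> \<noteq> lam\<close> by blast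
    then have "y \<in> lower" using y(1) unfolding lower_def by (blast intro: complex_vector.span_base)
    then show False using highest_weight_vector_lower y by blast
  qed
  have "z - c *\<^sub>C v \<in> weight_space \<iota> act lam"
    using z(2) v_weight \<nu> by (simp add: complex_vector.subspace_diff complex_vector.subspace_scale weight_space_subspace)
  then have "z - c *\<^sub>C v = 0" using highest_weight_vector_lower[OF c] by blast
  then show thesis using that[OF \<nu> _ c0] by simp
qed

text \<open>The largest proper submodule, that is, the kernel of the map onto the simple quotient.\<close>

definition radical :: "'v set"
  where "radical = {y. \<forall>is. word act e is y \<in> lower}"

lemma word_e_h:
  "word act e is (act (\<iota> h) y) = act (\<iota> h) (word act e is y) - sum_list (map \<alpha> is) h *\<^sub>C word act e is y"
proof (induction "is")
  case (Cons i js)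
  show ?case
    by (simp add: Cons act_commute[of "\<iota> h" "e i"] bracket_h_e scaleC_add_left)
qed simp

text \<open>For \<open>f i\<close>, the letter of the word that acts first is commuted past it; the
  commutator is zero or a coroot, under which stability is already known. The empty word is covered
  by \<open>f_lower\<close>.\<close>

lemma radical_submodule: "submodule act radical"
proof -
  have sub: "complex_vector.subspace radical"
    using lower_subspace by (auto simp: radical_def complex_vector.subspace_def)
  have e: "act (e k) y \<in> radical" if "y \<in> radical" for k y
    unfolding radical_def
  proof safe
    fix js
    have "word act e (js @ [k]) y \<in> lower" using that unfolding radical_def by blast
    then show "word act e js (act (e k) y) \<in> lower" by simp
  qed
  have h: "act (\<iota> h) y \<in> radical" if "y \<in> radical" for h y
    unfolding radical_def
  proof safe
    fix js
    have "word act e js y \<in> lower" using that unfolding radical_def by blast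
    then show "word act e js (act (\<iota> h) y) \<in> lower"
      unfolding word_e_h using h_lower lower_subspace
      by (intro complex_vector.subspace_diff complex_vector.subspace_scale)
  qed
  have "word act e is (act (f i) y) \<in> lower" if "y \<in> radical" for "is" i y
    using that
  proof (induction "is" arbitrary: y rule: rev_induct)
    case Nil
    then show ?case by (simp add: f_lower)
  next
    case (snoc k js)
    have "word act e js (act (bracket (e k) (f i)) y) \<in> lower"
      using h[OF snoc.prems] lower_subspace
      by (auto simp: bracket_e_f radical_def complex_vector.subspace_0)
    moreover have "word act e js (act (f i) (act (e k) y)) \<in> lower"
      using snoc.IH e[OF snoc.prems] .
    ultimately show ?case
      using lower_subspace by (simp add: act_commute[of "e k" "f i"] complex_vector.subspace_add)
  qed
  then have f: "act (f i) y \<in> radical" if "y \<in> radical" for i y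
    using that unfolding radical_def by blast
  have "act x y \<in> radical" if "y \<in> radical" for x y
    using act_generated_closed[OF sub _ in_generated that] e h f by blast
  with sub show ?thesis by (simp add: submodule_def)
qed

text \<open>By the Leibniz rule and \<open>f_nilpotent\<close>, the torsion \<open>?T\<close> is
  stable under the algebra. A word in the \<open>e\<close> carries \<open>y\<close> to a multiple of
  \<open>v\<close>, so \<open>v\<close> would be torsion too; but powers of \<open>e i\<close> undo
  powers of \<open>f i\<close> on \<open>v\<close>.\<close>

lemma f_injective_mod_radical:
  assumes i: "lam (coroot i) \<notin> \<nat>" and y: "y \<in> weight_space \<iota> act \<mu>" "y \<notin> radical"
  shows "act (f i) y \<notin> radical"
proof
  assume fy: "act (f i) y \<in> radical"
  let ?T = "{x. \<exists>n. (act (f i) ^^ n) x \<in> radical}"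
  have cl: "(act (f i) ^^ (m + n)) x \<in> radical" if "(act (f i) ^^ n) x \<in> radical" for m n x
    using that radical_submodule by (induction m) (auto simp: submodule_def)
  have T: "act z x \<in> ?T" if x: "x \<in> ?T" for z x
  proof -
    obtain n where "(act (f i) ^^ n) x \<in> radical" using x by blast
    moreover obtain m where "(bracket (f i) ^^ m) z = 0" using f_nilpotent by blast
    ultimately show ?thesis using funpow_act_in_submodule[OF radical_submodule] by blast
  qed
  have "(act (f i) ^^ 1) y \<in> radical" using fy by simp
  then have yT: "y \<in> ?T" by blast
  obtain js where js: "word act e js y \<notin> lower" using y(2) unfolding radical_def by blast
  obtain c where c: "word act e js y = c *\<^sub>C v" "c \<noteq> 0"
    using not_lower_highest[OF js word_weight_space[where x = e, OF e_weight y(1)]] by metis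
  have "word act e is y \<in> ?T" for "is"
    using yT T by (induction "is") auto
  then obtain n where "(act (f i) ^^ n) (c *\<^sub>C v) \<in> radical" unfolding c(1)[symmetric] by blast
  then have "(1 / c) *\<^sub>C (act (f i) ^^ n) (c *\<^sub>C v) \<in> radical"
    using radical_submodule complex_vector.subspace_scale unfolding submodule_def by blast
  then have "(act (f i) ^^ n) v \<in> radical" using c(2) by simp
  then have "word act e (replicate n i) ((act (f i) ^^ n) v) \<in> lower" unfolding radical_def by blast
  then have low: "(act (e i) ^^ n) ((act (f i) ^^ n) v) \<in> lower" by (simp only: word_replicate)
  \<comment> \<open>The scalar \<open>d\<close> is a product of sl2 coefficients, which are nonzero
    since \<open>lam (coroot i)\<close> is not a natural number.\<close>
  have "\<exists>d. d \<noteq> 0 \<and> (act (e i) ^^ n) ((act (f i) ^^ n) v) = d *\<^sub>C v" for n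
  proof (induction n)
    case 0
    show ?case by (auto intro: exI[of _ 1])
  next
    case (Suc n)
    then obtain d where d: "d \<noteq> 0" "(act (e i) ^^ n) ((act (f i) ^^ n) v) = d *\<^sub>C v" by blast
    let ?k = "of_nat (Suc n) * (lam (coroot i) - of_nat n)"
    have "act (e i) ((act (f i) ^^ Suc n) v) = ?k *\<^sub>C (act (f i) ^^ n) v"
      by (rule sl2_string(2)[OF f_sl2 e_v weight_spaceD[OF v_weight]])
    then have "(act (e i) ^^ Suc n) ((act (f i) ^^ Suc n) v) = (?k * d) *\<^sub>C v"
      using d(2) by (simp only: funpow_Suc_right o_apply funpow_act_simps scaleC_scaleC)
    moreover have "lam (coroot i) \<noteq> of_nat n" using i by auto
    then have "?k * d \<noteq> 0" using d(1) by (simp del: of_nat_Suc)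
    ultimately show ?case by blast
  qed
  then obtain d where d: "d \<noteq> 0" "(act (e i) ^^ n) ((act (f i) ^^ n) v) = d *\<^sub>C v" by blast
  have "d *\<^sub>C v \<in> weight_space \<iota> act lam"
    using v_weight by (rule complex_vector.subspace_scale[OF weight_space_subspace])
  then have "d *\<^sub>C v = 0" using highest_weight_vector_lower[OF low[unfolded d(2)]] by blast
  then show False using d(1) v_nonzero by simp
qed

lemma word_e_f_commute:
  assumes "set ls \<inter> set js = {}"
  shows "word act e ls (word act f js y) = word act f js (word act e ls y)"
proof -
  have "act (e i) (word act f js y) = word act f js (act (e i) y)" if "i \<notin> set js" for i y
    using that by (induction js) (auto simp: act_commute[of "e i" "f _"] bracket_e_f)
  then show ?thesis using assms by (induction ls) auto
qed

lemma integrable_nodes_lower_bound: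
  assumes J: "J = integrable_nodes coroot lam"
  shows "wt_of \<iota> \<alpha> act lam J \<ominus> nat_combs (\<alpha> ` (- J)) \<subseteq> wt \<iota> act"
proof
  fix \<nu> assume "\<nu> \<in> wt_of \<iota> \<alpha> act lam J \<ominus> nat_combs (\<alpha> ` (- J))"
  then obtain \<mu> ks where \<mu>: "\<mu> \<in> wt_of \<iota> \<alpha> act lam J" and ks: "set ks \<subseteq> - J"
      and \<nu>: "\<nu> = \<mu> - sum_list (map \<alpha> ks)"
    unfolding nat_combs_image minkowski_diff_def by blast
  obtain js where js: "\<mu> = lam - sum_list (map \<alpha> js)" "word act f js v \<noteq> 0"
    using \<mu> unfolding wt_of_def by (blast elim: weights_words)
  have "set js \<subseteq> J"
    using \<mu> count_list_0_iff[of js] unfolding js(1) sum_list_eq_rt wt_of_rt by force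
  \<comment> \<open>The letters of \<open>ks\<close> act on \<open>v\<close> before those of
    \<open>js\<close>, so that a raising word can pass through \<open>js\<close> and then undo
    \<open>ks\<close>.\<close>
  let ?y = "word act f ks v"
  have "?y \<notin> radical"
    using ks
  proof (induction ks)
    case Nil
    have "word act e [] y \<in> lower" if "y \<in> radical" for y
      using that unfolding radical_def by blast
    then show ?case using highest_weight_vector_lower v_weight v_nonzero by auto
  next
    case (Cons i ks)
    then have "lam (coroot i) \<notin> \<nat>" unfolding J integrable_nodes_def by auto
    from f_injective_mod_radical[OF this f_word_lower[OF v_weight]] Cons show ?case by simp
  qed
  then obtain ls where ls: "word act e ls ?y \<notin> lower" unfolding radical_def by blast
  obtain c where c: "sum_list (map \<alpha> ls) + (lam - sum_list (map \<alpha> ks)) = lam" "word act e ls ?y = c *\<^sub>C v" "c \<noteq> 0"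
    using not_lower_highest[OF ls word_weight_space[where x = e, OF e_weight f_word_lower[OF v_weight]]] by metis
  \<comment> \<open>Comparing weights shows that \<open>ls\<close> uses the same letters as
    \<open>ks\<close>, so none from \<open>J\<close>, which lets it commute with the word in
    \<open>js\<close>.\<close>
  have "sum_list (map \<alpha> ls) = sum_list (map \<alpha> ks)" using c(1) by (metis add.commute add_diff_eq add_left_cancel diff_add_cancel)
  then have "set ls = set ks" by (rule sum_list_roots_eqD)
  then have "set ls \<inter> set js = {}" using ks \<open>set js \<subseteq> J\<close> by auto
  then have "word act e ls (word act f js ?y) = c *\<^sub>C word act f js v"
    by (simp add: word_e_f_commute c(2))
  then have nz: "word act f js ?y \<noteq> 0" using js(2) c(3) by fastforce
  have "word act f js ?y \<in> weight_space \<iota> act (lam - sum_list (map \<alpha> ks) - sum_list (map \<alpha> js))"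
    by (rule f_word_lower[OF f_word_lower[OF v_weight]])
  also have "lam - sum_list (map \<alpha> ks) - sum_list (map \<alpha> js) = \<nu>"
    by (simp add: \<nu> js(1) fun_eq_iff)
  finally show "\<nu> \<in> wt \<iota> act"
    by (rule wtI[OF _ nz]) (simp only: \<nu> js(1) dual_closed lam_dual root_dual_closed)
qed

end

theorem theoremC:
  fixes A :: "int ^ 'i::finite ^ 'i"
    and coroot :: "'i \<Rightarrow> 'h::complex_vector"
    and \<alpha> :: "'i \<Rightarrow> 'h \<Rightarrow> complex"
    and \<iota> :: "'h \<Rightarrow> 'g::complex_lie_algebra"
    and e f :: "'i \<Rightarrow> 'g"
    and act :: "'g \<Rightarrow> 'v::complex_vector \<Rightarrow> 'v"
    and lam :: "'h \<Rightarrow> complex"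
  assumes "kac_moody_algebra A coroot \<alpha> \<iota> e f"
    and "lam \<in> dual"
    and "highest_weight_module \<iota> e act lam"
    and "(UNIV :: 'v set) \<noteq> {0}"
  shows "(let Jl = integrable_nodes coroot lam in
      wt \<iota> act = wt_of \<iota> \<alpha> act lam Jl \<ominus> nat_combs (roots_ht1 \<iota> \<alpha> (- Jl)) \<and>
      wt \<iota> act = wt_of \<iota> \<alpha> act lam Jl
        \<ominus> nat_combs (pos_roots \<iota> \<alpha> - pos_roots_of \<iota> \<alpha> Jl)) \<and>
    (\<forall>J :: 'i set.
      wt_of \<iota> \<alpha> act lam J \<ominus> nat_combs (\<alpha> ` (- J)) \<subseteq> wt \<iota> act \<longleftrightarrow>
      wt \<iota> act = wt_of \<iota> \<alpha> act lam J \<ominus> nat_combs (roots_ht1 \<iota> \<alpha> (- J)))"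
proof -
  obtain v where v: "lie_module act" "v \<in> weight_space \<iota> act lam"
      "\<And>x. x \<in> lie_generated (range e) \<Longrightarrow> act x v = 0" "generated_submodule act {v} = UNIV"
    using assms(3) unfolding highest_weight_module_def by blast
  have "act (e i) v = 0" for i by (rule v(3)) (auto intro: lie_generated_base)
  \<comment> \<open>A zero generator would make the whole module zero.\<close>
  moreover have "v \<noteq> 0"
  proof
    interpret lie_rep act by (rule lie_rep.intro) (rule v(1))
    assume "v = 0"
    moreover have "submodule act {0}" by (auto simp: submodule_def)
    ultimately have "generated_submodule act {v} \<subseteq> {0}" by (auto simp: generated_submodule_def)
    then show False using v(4) assms(4) by auto
  qed
  ultimately interpret highest_weight A coroot \<alpha> \<iota> e f act lam v
    using assms(1,2) v by (intro highest_weight.intro highest_weight_axioms.intro lie_rep.intro)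
  show ?thesis
    \<comment> \<open>This rewriting makes the second equality identical to the first.\<close>
    unfolding Let_def nat_combs_positive_roots
    using integrable_nodes_lower_bound[OF refl] weights_eq_iff by blast
qed

end
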